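(* Let $X$ be a proper, geodesic, metric space. Let $G$ be a group acting properly, by isometries on $X$ with a contracting element. Let $N$ be a normal subgroup of $G$. If $G/N$ is amenable, then $\omega(N,X)=\omega(G,X)$.
   Context: Fix a base point $o\in X$. A geodesic is a path $\gamma: I\to X$ ($I\subset\mathbb R$ an interval) with $d(\gamma(t),\gamma(t'))=|t-t'|$ for all $t,t'\in I$; $X$ is geodesic if any two points are joined by a geodesic, and proper if closed balls are compact. The group $G$ is endowed with the discrete topology. Contracting elements: let $Y\subset X$ be closed. A projection of $x\in X$ on $Y$ is a point $y\in Y$ with $d(x,y)=d(x,Y)$; for $Z\subset X$, $\pi_Y(Z)$ is the set of all projections on $Y$ of points of $Z$. For $\alpha>0$, $Y$ is $\alpha$-contracting if for every geodesic $\gamma$ with $d(\gamma,Y)\ge\alpha$ (where $d(\gamma,Y)$ is the infimum of distances between points of $\gamma$ and of $Y$) we have $\mathrm{diam}\,\pi_Y(\gamma)\le\alpha$; $Y$ is contracting if it is $\alpha$-contracting for some $\alpha>0$. An element $g\in G$ is contracting if, for $y\in X$, the orbit map $\mathbb Z\to X$, $n\mapsto g^ny$, is a quasi-isometric embedding with contracting image (this does not depend on $y$). Growth: for a subgroup $H\subset G$, $\omega(H,X)=\limsup_{\ell\to\infty}\frac1\ell\ln \#\{h\in H : d(o,ho)\le \ell\}$. Amenability: a discrete group $Q$ is amenable if there is a $Q$-invariant mean $\ell^\infty(Q)\to\mathbb R$, for the action of $Q$ on $\ell^\infty(Q)$ induced by left translations. *)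

theory Defs
  imports "HOL-Analysis.Analysis" "HOL-Algebra.Group_Action"
begin

text \<open>
  The metric space X is a type of class \<^class>\<open>metric_space\<close>; the group G is a HOL-Algebra group
  acting on X through \<open>\<phi>\<close>, i.e. \<open>\<phi> g x\<close> is the point \<open>g x\<close>.
\<close>

definition geodesic_on :: "real set \<Rightarrow> (real \<Rightarrow> 'x::metric_space) \<Rightarrow> bool" where
  "geodesic_on I \<gamma> \<longleftrightarrow>
     is_interval I \<and> (\<forall>t\<in>I. \<forall>t'\<in>I. dist (\<gamma> t) (\<gamma> t') = \<bar>t - t'\<bar>)"

definition geodesic_space :: "'x::metric_space itself \<Rightarrow> bool" where
  "geodesic_space _ \<longleftrightarrow>
     (\<forall>x y :: 'x. \<exists>a b \<gamma>. a \<le> b \<and> geodesic_on {a..b} \<gamma> \<and> \<gamma> a = x \<and> \<gamma> b = y)"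

definition proper_space :: "'x::metric_space itself \<Rightarrow> bool" where
  "proper_space _ \<longleftrightarrow> (\<forall>(x::'x) r. compact (cball x r))"

definition proj_set :: "'x::metric_space set \<Rightarrow> 'x set \<Rightarrow> 'x set" where
  "proj_set Y Z = {y \<in> Y. \<exists>z\<in>Z. dist z y = infdist z Y}"

text \<open>
  \<^const>\<open>diameter\<close> is only meaningful on bounded sets, so \<open>diam \<le> \<alpha>\<close> has to include boundedness.
\<close>

definition alpha_contracting :: "real \<Rightarrow> 'x::metric_space set \<Rightarrow> bool" where
  "alpha_contracting \<alpha> Y \<longleftrightarrow>
     closed Y \<and>
     (\<forall>I \<gamma>. geodesic_on I \<gamma> \<longrightarrow> setdist (\<gamma> ` I) Y \<ge> \<alpha> \<longrightarrow>
        bounded (proj_set Y (\<gamma> ` I)) \<and> diameter (proj_set Y (\<gamma> ` I)) \<le> \<alpha>)"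

definition contracting_set :: "'x::metric_space set \<Rightarrow> bool" where
  "contracting_set Y \<longleftrightarrow> (\<exists>\<alpha>>0. alpha_contracting \<alpha> Y)"

definition isometric_action ::
  "('g, 'm) monoid_scheme \<Rightarrow> ('g \<Rightarrow> 'x::metric_space \<Rightarrow> 'x) \<Rightarrow> bool" where
  "isometric_action G \<phi> \<longleftrightarrow>
     group_action G UNIV \<phi> \<and> (\<forall>g\<in>carrier G. \<forall>x y. dist (\<phi> g x) (\<phi> g y) = dist x y)"

definition proper_action ::
  "('g, 'm) monoid_scheme \<Rightarrow> ('g \<Rightarrow> 'x::metric_space \<Rightarrow> 'x) \<Rightarrow> bool" where
  "proper_action G \<phi> \<longleftrightarrow>
     (\<forall>K. compact K \<longrightarrow> finite {g \<in> carrier G. \<phi> g ` K \<inter> K \<noteq> {}})"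

definition int_quasi_isometric_embedding :: "(int \<Rightarrow> 'x::metric_space) \<Rightarrow> bool" where
  "int_quasi_isometric_embedding f \<longleftrightarrow>
     (\<exists>\<kappa>\<ge>1. \<exists>c\<ge>0. \<forall>n k.
        of_int \<bar>n - k\<bar> / \<kappa> - c \<le> dist (f n) (f k) \<and>
        dist (f n) (f k) \<le> \<kappa> * of_int \<bar>n - k\<bar> + c)"

definition contracting_element ::
  "('g, 'm) monoid_scheme \<Rightarrow> ('g \<Rightarrow> 'x::metric_space \<Rightarrow> 'x) \<Rightarrow> 'g \<Rightarrow> bool" where
  "contracting_element G \<phi> g \<longleftrightarrow>
     g \<in> carrier G \<and>
     (\<forall>y. int_quasi_isometric_embedding (\<lambda>n::int. \<phi> (g [^]\<^bsub>G\<^esub> n) y) \<and>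
          contracting_set (range (\<lambda>n::int. \<phi> (g [^]\<^bsub>G\<^esub> n) y)))"

text \<open>
  Growth rate of the subset \<open>H\<close> of the acting group with respect to the base point \<open>p\<close>.
  It may be infinite, hence the extended reals. The counted sets are finite for a proper action
  on a proper space.
\<close>

definition growth_rate ::
  "('g \<Rightarrow> 'x::metric_space \<Rightarrow> 'x) \<Rightarrow> 'x \<Rightarrow> 'g set \<Rightarrow> ereal" where
  "growth_rate \<phi> p H =
     Limsup at_top (\<lambda>l::real. ereal (1 / l * ln (real (card {h \<in> H. dist p (\<phi> h p) \<le> l}))))"

text \<open>
  Bounded functions on \<open>carrier Q\<close> are represented by total functions with arbitrary values
  outside the carrier. Linearity and positivity force a mean to give the same value to any two
  representatives of the same bounded function.
\<close>

definition ell_infty :: "('q, 'm) monoid_scheme \<Rightarrow> ('q \<Rightarrow> real) set" where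
  "ell_infty Q = {f. bounded (f ` carrier Q)}"

definition mean_on :: "('q, 'm) monoid_scheme \<Rightarrow> (('q \<Rightarrow> real) \<Rightarrow> real) \<Rightarrow> bool" where
  "mean_on Q m \<longleftrightarrow>
     (\<forall>f\<in>ell_infty Q. \<forall>h\<in>ell_infty Q. m (\<lambda>x. f x + h x) = m f + m h) \<and>
     (\<forall>c. \<forall>f\<in>ell_infty Q. m (\<lambda>x. c * f x) = c * m f) \<and>
     (\<forall>f\<in>ell_infty Q. (\<forall>x\<in>carrier Q. f x \<ge> 0) \<longrightarrow> m f \<ge> 0) \<and>
     m (\<lambda>x. 1) = 1"

definition amenable :: "('q, 'm) monoid_scheme \<Rightarrow> bool" where
  "amenable Q \<longleftrightarrow>
     (\<exists>m. mean_on Q m \<and>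
          (\<forall>q\<in>carrier Q. \<forall>f\<in>ell_infty Q. m (\<lambda>x. f (inv\<^bsub>Q\<^esub> q \<otimes>\<^bsub>Q\<^esub> x)) = m f))"

end

theory Submission
  imports Defs "HOL-Real_Asymp.Real_Asymp"
begin

text \<open>
  Suppose \<open>\<omega>(N) < s < \<omega>(G)\<close>. The Poincare series of the cosets of \<open>N\<close> at exponent \<open>s\<close> converge and
  define a positive function \<open>v\<close> on \<open>G/N\<close>. Averaging the cocycle \<open>ln v (q\<inverse> x) - ln v x\<close> with the
  invariant mean gives a homomorphism \<open>\<Phi>\<close> from \<open>G\<close> to the reals. If a finite family \<open>S\<close> of group
  elements satisfies \<open>\<Sum>h\<in>S. exp (- s * d(x, h p)) \<le> \<beta> * card S * exp (- s * d(x, p))\<close> for all \<open>x\<close>,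
  with \<open>\<beta> < 1\<close>, then \<open>ln y \<le> y - 1\<close> yields \<open>\<Sum>h\<in>S. \<Phi> h < 0\<close>. A family for which both \<open>S\<close> and
  conjugates of the inverses have this property is therefore impossible.

  Such families consist of words \<open>a1 f a2 f \<dots> ak f\<close>, where \<open>f\<close> is a high power of the contracting
  element and the \<open>ai\<close> range over more than \<open>exp (s m)\<close> elements of length about \<open>m\<close> whose orbit
  points project near \<open>p\<close> on the axis. The powers of \<open>f\<close> act as barriers: the geodesic from \<open>p\<close>
  to \<open>x\<close> can follow a word through its first \<open>j\<close> letters only for a proportion of words
  exponentially small in \<open>j m\<close>.
\<close>

section \<open>Projections onto contracting sets\<close>

lemma mem_proj_set_singleton:
  "y \<in> proj_set Y {x} \<longleftrightarrow> y \<in> Y \<and> dist x y = infdist x Y"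
  by (simp add: proj_set_def)

lemma proj_set_self:
  assumes "x \<in> Y"
  shows "x \<in> proj_set Y {x}"
  using assms by (simp add: mem_proj_set_singleton infdist_zero)

text \<open>Only the part of Y inside a closed ball about x matters, and properness makes that part
  compact.\<close>

lemma proj_set_nonempty:
  fixes Y :: "'x::metric_space set"
  assumes "proper_space TYPE('x)" "closed Y" "Y \<noteq> {}"
  shows "proj_set Y {x} \<noteq> {}"
proof -
  obtain y0 where y0: "y0 \<in> Y" using assms(3) by blast
  let ?K = "cball x (dist x y0) \<inter> Y"
  have "compact ?K"
    using assms by (simp add: proper_space_def compact_Int_closed)
  moreover have "?K \<noteq> {}" using y0 by auto
  moreover have "continuous_on ?K (dist x)" by (intro continuous_intros)
  ultimately obtain y where y: "y \<in> ?K" "\<And>z. z \<in> ?K \<Longrightarrow> dist x y \<le> dist x z"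
    using continuous_attains_inf[of ?K "dist x"] by blast
  have min: "dist x y \<le> dist x z" if "z \<in> Y" for z
    using y(2)[of z] y(2)[of y0] y0 that by (cases "z \<in> ?K") auto
  have "dist x y = infdist x Y"
  proof (rule antisym)
    show "dist x y \<le> infdist x Y"
      using min assms(3) by (auto simp: infdist_def intro: cINF_greatest)
    show "infdist x Y \<le> dist x y"
      using y(1) by (auto intro: infdist_le)
  qed
  then show ?thesis using y(1) by (auto simp: mem_proj_set_singleton)
qed

lemma geodesic_on_subset:
  assumes "geodesic_on I \<gamma>" "J \<subseteq> I" "is_interval J"
  shows "geodesic_on J \<gamma>"
  using assms unfolding geodesic_on_def by blast

lemma geodesic_on_reverse:
  assumes "geodesic_on {a..b} \<gamma>"
  shows "geodesic_on {-b..-a} (\<lambda>t. \<gamma> (- t))"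
  unfolding geodesic_on_def
proof (intro conjI ballI)
  fix t t' assume "t \<in> {-b..-a}" "t' \<in> {-b..-a}"
  then have "- t \<in> {a..b}" "- t' \<in> {a..b}" by auto
  then have "dist (\<gamma> (- t)) (\<gamma> (- t')) = \<bar>- t - - t'\<bar>"
    using assms unfolding geodesic_on_def by blast
  then show "dist (\<gamma> (- t)) (\<gamma> (- t')) = \<bar>t - t'\<bar>" by linarith
qed (rule is_interval_cc)

text \<open>Pointwise form of the contraction property. The definition also provides boundedness, so
  the bound on the diameter applies to each pair of projections.\<close>

lemma alpha_contracting_far_geodesic:
  assumes "alpha_contracting \<alpha> Y" "Y \<noteq> {}" "geodesic_on {a..b} \<gamma>" "a \<le> b"
    and far: "\<And>t. t \<in> {a..b} \<Longrightarrow> \<alpha> \<le> infdist (\<gamma> t) Y"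
    and "s \<in> {a..b}" "s' \<in> {a..b}"
    and "y \<in> proj_set Y {\<gamma> s}" "y' \<in> proj_set Y {\<gamma> s'}"
  shows "dist y y' \<le> \<alpha>"
proof -
  let ?P = "proj_set Y (\<gamma> ` {a..b})"
  have "\<alpha> \<le> setdist (\<gamma> ` {a..b}) Y"
  proof (rule le_setdistI)
    fix u v assume "u \<in> \<gamma> ` {a..b}" "v \<in> Y"
    then show "\<alpha> \<le> dist u v" using far infdist_le[of v Y u] by fastforce
  qed (use assms in auto)
  then have "bounded ?P" "diameter ?P \<le> \<alpha>"
    using assms unfolding alpha_contracting_def by blast+
  moreover have "y \<in> ?P" "y' \<in> ?P"
    using assms by (auto simp: proj_set_def)
  ultimately show ?thesis
    using diameter_bounded_bound[of ?P y y'] by linarith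
qed

text \<open>Take the first time t at which the geodesic is within \<alpha> of Y. Up to t it stays
  far from Y, so the projections of \<open>\<gamma> a\<close> and \<open>\<gamma> t\<close> are
  \<alpha>-close, and \<open>\<gamma> t\<close> is within \<alpha> of its own projection.\<close>

lemma contracting_geodesic_entry:
  assumes ps: "proper_space TYPE('x::metric_space)"
    and con: "alpha_contracting \<alpha> Y" and Y: "Y \<noteq> {}" and "0 < \<alpha>"
    and geo: "geodesic_on {a..b} (\<gamma> :: real \<Rightarrow> 'x)" and "a \<le> b"
    and y: "y \<in> proj_set Y {\<gamma> a}"
    and t0: "t0 \<in> {a..b}" "infdist (\<gamma> t0) Y \<le> \<alpha>"
  shows "\<exists>t\<in>{a..t0}. dist (\<gamma> t) y \<le> 2 * \<alpha>"
proof -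
  have geoD: "dist (\<gamma> t) (\<gamma> t') = \<bar>t - t'\<bar>" if "t \<in> {a..b}" "t' \<in> {a..b}" for t t'
    using geo that by (auto simp: geodesic_on_def)
  let ?T = "{t \<in> {a..b}. infdist (\<gamma> t) Y \<le> \<alpha>}"
  have cont: "continuous_on {a..b} (\<lambda>t. infdist (\<gamma> t) Y)"
  proof (intro continuous_on_infdist)
    show "continuous_on {a..b} \<gamma>"
      unfolding continuous_on_iff by (metis geoD dist_real_def)
  qed
  have comp: "compact ?T"
    unfolding compact_eq_bounded_closed
  proof
    show "bounded ?T" by (rule bounded_subset[OF bounded_closed_interval[of a b]]) auto
    show "closed ?T"
      using continuous_closed_preimage[OF cont, of "{..\<alpha>}"] by (simp add: vimage_def Int_def)
  qed
  have "?T \<noteq> {}" using t0 by blast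
  from compact_attains_inf[OF comp this]
  obtain t where t: "t \<in> ?T" and tmin: "\<And>s. s \<in> ?T \<Longrightarrow> t \<le> s"
    by blast
  \<comment> \<open>Before t the inequality is strict by minimality. At t it follows by approaching
    t from the left, as \<open>infdist\<close> is 1-Lipschitz; if t = a, the second alternative
    gives it directly.\<close>
  have far: "\<alpha> \<le> infdist (\<gamma> s) Y" if s: "s \<in> {a..t}" "a < t \<or> infdist (\<gamma> a) Y = \<alpha>" for s
  proof (cases "s < t")
    case True
    then show ?thesis using tmin[of s] s t by force
  next
    case False
    then have [simp]: "s = t" using s by simp
    show ?thesis
    proof (cases "a < t")
      case True
      show ?thesis
      proof (rule field_le_epsilon)
        fix e :: real assume "0 < e"
        define r where "r = max a (t - e)"
        have r: "r \<in> {a..b}" "r < t" "t - r \<le> e"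
          using t True \<open>0 < e\<close> by (auto simp: r_def)
        have "\<alpha> < infdist (\<gamma> r) Y" using tmin[of r] r by force
        also have "\<dots> \<le> infdist (\<gamma> t) Y + dist (\<gamma> r) (\<gamma> t)" by (rule infdist_triangle)
        also have "dist (\<gamma> r) (\<gamma> t) \<le> e" using geoD[of r t] r t by auto
        finally show "\<alpha> \<le> infdist (\<gamma> s) Y + e" by simp
      qed
    next
      case False
      then show ?thesis using s t by auto
    qed
  qed
  have "dist (\<gamma> t) y \<le> 2 * \<alpha>"
  proof (cases "a < t")
    case True
    obtain y' where y': "y' \<in> proj_set Y {\<gamma> t}"
      using proj_set_nonempty[OF ps, of Y "\<gamma> t"] con Y by (auto simp: alpha_contracting_def)
    have "geodesic_on {a..t} \<gamma>"
      using geo t by (intro geodesic_on_subset[OF geo]) auto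
    then have "dist y y' \<le> \<alpha>"
      using alpha_contracting_far_geodesic[OF con Y, of a t \<gamma> a t y y'] far True y y' by auto
    moreover have "dist (\<gamma> t) y' \<le> \<alpha>"
      using y' t by (simp add: mem_proj_set_singleton)
    ultimately show ?thesis using dist_triangle2[of "\<gamma> t" y y'] by linarith
  next
    case False
    then have "t = a" using t by auto
    then show ?thesis using t y \<open>0 < \<alpha>\<close> by (auto simp: mem_proj_set_singleton)
  qed
  then show ?thesis using t tmin[of t0] t0 by auto
qed

text \<open>Some time t0 is within \<alpha> of Y, since otherwise contraction would bring y and y'
  within \<alpha> of each other. Applying \<open>contracting_geodesic_entry\<close> on both sides of
  the same t0, once along the reversed geodesic, yields the order \<open>t \<le> t'\<close>.\<close>

lemma contracting_geodesic_near_projections: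
  assumes ps: "proper_space TYPE('x::metric_space)"
    and con: "alpha_contracting \<alpha> Y" and Y: "Y \<noteq> {}" and "0 < \<alpha>"
    and geo: "geodesic_on {a..b} (\<gamma> :: real \<Rightarrow> 'x)" and "a \<le> b"
    and y: "y \<in> proj_set Y {\<gamma> a}" and y': "y' \<in> proj_set Y {\<gamma> b}"
    and gap: "\<alpha> < dist y y'"
  obtains t t' where "a \<le> t" "t \<le> t'" "t' \<le> b" "dist (\<gamma> t) y \<le> 2 * \<alpha>" "dist (\<gamma> t') y' \<le> 2 * \<alpha>"
proof -
  obtain t0 where t0: "t0 \<in> {a..b}" "infdist (\<gamma> t0) Y \<le> \<alpha>"
    using alpha_contracting_far_geodesic[OF con Y geo \<open>a \<le> b\<close>, of a b y y'] y y' gap \<open>a \<le> b\<close>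
    by (metis atLeastAtMost_iff less_eq_real_def linorder_not_less)
  obtain t where t: "t \<in> {a..t0}" "dist (\<gamma> t) y \<le> 2 * \<alpha>"
    using contracting_geodesic_entry[OF ps con Y \<open>0 < \<alpha>\<close> geo \<open>a \<le> b\<close> y t0] by blast
  obtain r where r: "r \<in> {-b..-t0}" "dist (\<gamma> (- r)) y' \<le> 2 * \<alpha>"
    using contracting_geodesic_entry[OF ps con Y \<open>0 < \<alpha>\<close> geodesic_on_reverse[OF geo], of y' "- t0"]
      t0 y' by auto
  show ?thesis
    by (rule that[of t "- r"]) (use t r in auto)
qed

lemma geodesic_space_segment:
  assumes "geodesic_space TYPE('x::metric_space)"
  obtains \<gamma> where "geodesic_on {0..dist x y} \<gamma>" "\<gamma> 0 = x" "\<gamma> (dist x y) = (y :: 'x)"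
proof -
  obtain a b \<gamma> where g: "a \<le> b" "geodesic_on {a..b} \<gamma>" "\<gamma> a = x" "\<gamma> b = y"
    using assms unfolding geodesic_space_def by blast
  have d: "dist x y = b - a"
    using g unfolding geodesic_on_def by fastforce
  show ?thesis
  proof (rule that[of "\<lambda>t. \<gamma> (t + a)"])
    show "geodesic_on {0..dist x y} (\<lambda>t. \<gamma> (t + a))"
      unfolding geodesic_on_def
    proof (intro conjI ballI)
      fix t t' assume "t \<in> {0..dist x y}" "t' \<in> {0..dist x y}"
      then have "t + a \<in> {a..b}" "t' + a \<in> {a..b}" using d by auto
      then have "dist (\<gamma> (t + a)) (\<gamma> (t' + a)) = \<bar>(t + a) - (t' + a)\<bar>"
        using g unfolding geodesic_on_def by blast
      then show "dist (\<gamma> (t + a)) (\<gamma> (t' + a)) = \<bar>t - t'\<bar>" by linarith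
    qed (rule is_interval_cc)
  qed (use g d in auto)
qed

text \<open>A geodesic from x to x' passes within 2\<alpha> of y and later within 2\<alpha> of y'.
  The three pieces lose 2, 4 and 2 times \<alpha>.\<close>

lemma contracting_dist_ge:
  assumes ps: "proper_space TYPE('x::metric_space)" and gs: "geodesic_space TYPE('x)"
    and con: "alpha_contracting \<alpha> Y" and Y: "Y \<noteq> {}" and "0 < \<alpha>"
    and y: "y \<in> proj_set Y {x}" and y': "y' \<in> proj_set Y {x' :: 'x}"
    and gap: "\<alpha> < dist y y'"
  shows "dist x y + dist y y' + dist y' x' - 8 * \<alpha> \<le> dist x x'"
proof -
  obtain \<gamma> where g: "geodesic_on {0..dist x x'} \<gamma>" "\<gamma> 0 = x" "\<gamma> (dist x x') = x'"
    using geodesic_space_segment[OF gs] by blast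
  obtain t t' where t: "0 \<le> t" "t \<le> t'" "t' \<le> dist x x'"
      "dist (\<gamma> t) y \<le> 2 * \<alpha>" "dist (\<gamma> t') y' \<le> 2 * \<alpha>"
    using contracting_geodesic_near_projections[OF ps con Y \<open>0 < \<alpha>\<close> g(1), of y y'] g y y' gap
    by auto
  have G: "dist (\<gamma> s) (\<gamma> s') = \<bar>s - s'\<bar>" if "s \<in> {0..dist x x'}" "s' \<in> {0..dist x x'}" for s s'
    using g that by (auto simp: geodesic_on_def)
  have "dist x (\<gamma> t) = t" "dist (\<gamma> t) (\<gamma> t') = t' - t" "dist (\<gamma> t') x' = dist x x' - t'"
    using G[of 0 t] G[of t t'] G[of t' "dist x x'"] g t by auto
  moreover have "dist x y \<le> dist x (\<gamma> t) + dist (\<gamma> t) y" by (rule dist_triangle)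
  moreover have "dist y' x' \<le> dist (\<gamma> t') y' + dist (\<gamma> t') x'" by (rule dist_triangle3)
  moreover have "dist y y' \<le> dist (\<gamma> t) y + dist (\<gamma> t) (\<gamma> t') + dist (\<gamma> t') y'"
    by (metis dist_commute dist_triangle dist_triangle_le add.commute add_left_mono order_trans)
  ultimately show ?thesis using t by linarith
qed

section \<open>Isometric actions\<close>

lemma dist_triangle4: "dist a d \<le> dist a b + dist b c + dist c (d :: 'a::metric_space)"
  using dist_triangle[of a d b] dist_triangle[of b d c] by linarith

locale isom_action = group G for G :: "('g, 'm) monoid_scheme" (structure) +
  fixes \<phi> :: "'g \<Rightarrow> 'x::metric_space \<Rightarrow> 'x" and p :: 'x
  assumes iso: "isometric_action G \<phi>"
begin

definition len :: "'g \<Rightarrow> real" where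
  "len h = dist p (\<phi> h p)"

lemma group_action: "group_action G UNIV \<phi>"
  using iso by (simp add: isometric_action_def)

lemma act_mult:
  assumes "h \<in> carrier G" "k \<in> carrier G"
  shows "\<phi> (h \<otimes> k) x = \<phi> h (\<phi> k x)"
  using group_action.composition_rule[OF group_action] assms by blast

lemma act_one [simp]: "\<phi> \<one> x = x"
  using group_action.id_eq_one[OF group_action] by (metis UNIV_I restrict_apply)

lemma act_inv [simp]:
  assumes "h \<in> carrier G"
  shows "\<phi> (inv h) (\<phi> h x) = x" "\<phi> h (\<phi> (inv h) x) = x"
  using assms by (simp_all flip: act_mult)

lemma dist_act [simp]: "h \<in> carrier G \<Longrightarrow> dist (\<phi> h x) (\<phi> h y) = dist x y"
  using iso by (simp add: isometric_action_def)

lemma dist_act_inv: "h \<in> carrier G \<Longrightarrow> dist (\<phi> (inv h) x) y = dist x (\<phi> h y)"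
  by (metis act_inv(2) dist_act)

lemma dist_act_inv2: "h \<in> carrier G \<Longrightarrow> dist y (\<phi> (inv h) x) = dist (\<phi> h y) x"
  by (metis act_inv(2) dist_act)

lemma len_one [simp]: "len \<one> = 0"
  by (simp add: len_def)

lemma len_nonneg [simp]: "0 \<le> len h"
  by (simp add: len_def)

lemma len_inv [simp]: "h \<in> carrier G \<Longrightarrow> len (inv h) = len h"
  by (metis dist_act_inv dist_commute len_def)

lemma len_mult_le:
  assumes "h \<in> carrier G" "k \<in> carrier G"
  shows "len (h \<otimes> k) \<le> len h + len k"
  using dist_triangle[of p "\<phi> h (\<phi> k p)" "\<phi> h p"] assms by (simp add: len_def act_mult)

lemma len_mult_ge:
  assumes "h \<in> carrier G" "k \<in> carrier G"
  shows "len k - len h \<le> len (h \<otimes> k)" "len h - len k \<le> len (h \<otimes> k)"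
proof -
  have "len (inv h \<otimes> (h \<otimes> k)) \<le> len (inv h) + len (h \<otimes> k)"
    using assms by (intro len_mult_le) auto
  then show "len k - len h \<le> len (h \<otimes> k)" using assms by (simp flip: m_assoc)
  have "len ((h \<otimes> k) \<otimes> inv k) \<le> len (h \<otimes> k) + len (inv k)"
    using assms by (intro len_mult_le) auto
  then show "len h - len k \<le> len (h \<otimes> k)" using assms by (simp add: m_assoc)
qed

end

section \<open>Elements in good position with respect to a contracting orbit\<close>

locale contracting_orbit = isom_action G \<phi> p
  for G :: "('g, 'm) monoid_scheme" (structure)
    and \<phi> :: "'g \<Rightarrow> 'x::metric_space \<Rightarrow> 'x" and p +
  fixes g :: 'g and \<alpha> :: real
  assumes ps: "proper_space TYPE('x)" and gs: "geodesic_space TYPE('x)"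
    and proper: "proper_action G \<phi>"
    and g_closed [simp]: "g \<in> carrier G"
    and qi: "int_quasi_isometric_embedding (\<lambda>n::int. \<phi> (g [^] n) p)"
    and alpha_pos: "0 < \<alpha>"
    and contracting: "alpha_contracting \<alpha> (range (\<lambda>n::int. \<phi> (g [^] n) p))"
begin

definition axis :: "'x set" where
  "axis = range (\<lambda>n::int. \<phi> (g [^] n) p)"

abbreviation proj :: "'x \<Rightarrow> 'x set" where
  "proj x \<equiv> proj_set axis {x}"

text \<open>Such an element moves the closed ball of radius l about p to a set that meets the ball,
  and this ball is compact.\<close>

lemma finite_len_le: "finite {h \<in> carrier G. len h \<le> l}"
proof -
  have "finite {h \<in> carrier G. \<phi> h ` cball p l \<inter> cball p l \<noteq> {}}"
    using proper ps by (simp add: proper_action_def proper_space_def)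
  moreover have ne: "\<phi> h ` cball p l \<inter> cball p l \<noteq> {}" if "len h \<le> l" for h
  proof -
    have "0 \<le> l" using that len_nonneg[of h] by linarith
    then have "\<phi> h p \<in> \<phi> h ` cball p l \<inter> cball p l" using that by (simp add: len_def)
    then show ?thesis by blast
  qed
  ultimately show ?thesis by (elim rev_finite_subset) blast
qed

lemma base_in_axis: "p \<in> axis"
  unfolding axis_def by (rule range_eqI[of _ _ 0]) simp

lemma axis_shift: "\<phi> (g [^] (n::int)) ` axis = axis"
proof -
  have "\<phi> (g [^] n) ` axis = range (\<lambda>k::int. \<phi> (g [^] (n + k)) p)"
    by (simp add: axis_def image_image act_mult int_pow_mult)
  also have "\<dots> = (\<lambda>k::int. \<phi> (g [^] k) p) ` range (\<lambda>k. n + k)"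
    by (simp only: image_image)
  also have "range (\<lambda>k. n + k) = UNIV" by (rule surj_plus)
  finally show ?thesis by (simp add: axis_def)
qed

lemma proj_nonempty: "proj x \<noteq> {}"
  using proj_set_nonempty[OF ps, of axis x] contracting base_in_axis
  by (auto simp: alpha_contracting_def axis_def)

lemma proj_shift:
  assumes "r \<in> proj x"
  shows "\<phi> (g [^] (n::int)) r \<in> proj (\<phi> (g [^] n) x)"
proof -
  have "infdist (\<phi> (g [^] n) x) axis = infdist (\<phi> (g [^] n) x) (\<phi> (g [^] n) ` axis)"
    by (simp add: axis_shift)
  also have "\<dots> = infdist x axis"
    using base_in_axis by (auto simp: infdist_def image_image)
  finally show ?thesis
    using assms axis_shift[of n] by (auto simp: mem_proj_set_singleton)
qed

lemma proj_dist_ge: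
  assumes "y \<in> proj x" "y' \<in> proj x'" "\<alpha> < dist y y'"
  shows "dist x y + dist y y' + dist y' x' - 8 * \<alpha> \<le> dist x x'"
  using contracting_dist_ge[OF ps gs contracting _ alpha_pos] assms by (auto simp: axis_def)

lemma proj_axis: "y \<in> axis \<Longrightarrow> y \<in> proj y"
  by (rule proj_set_self)

lemma proj_in_axis: "y \<in> proj x \<Longrightarrow> y \<in> axis"
  by (simp add: mem_proj_set_singleton)

lemma axisE:
  assumes "y \<in> axis"
  obtains n :: int where "y = \<phi> (g [^] n) p"
  using assms unfolding axis_def by blast

text \<open>
  The multiples of \<open>\<alpha>\<close> below (16, 40, 46, 64) are accumulated errors \<open>8 * \<alpha>\<close> from
  \<open>proj_dist_ge\<close>, with no attempt at optimality.
\<close>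

definition good :: "'g \<Rightarrow> bool" where
  "good a \<longleftrightarrow> a \<in> carrier G \<and> (\<forall>r \<in> proj (\<phi> a p) \<union> proj (\<phi> (inv a) p). dist p r \<le> 16 * \<alpha>)"

text \<open>Unlike \<open>good\<close>, this is one-sided and has a larger constant: it is the form
  that survives prefixing by a good letter and a power of g, see \<open>tame_step\<close>.\<close>

definition tame :: "'g \<Rightarrow> bool" where
  "tame w \<longleftrightarrow> w \<in> carrier G \<and> (\<forall>r \<in> proj (\<phi> w p). dist p r \<le> 46 * \<alpha>)"

lemma good_closed: "good a \<Longrightarrow> a \<in> carrier G"
  and tame_closed: "tame w \<Longrightarrow> w \<in> carrier G"
  by (simp_all add: good_def tame_def)

lemma good_inv: "good a \<Longrightarrow> good (inv a)"
  by (auto simp: good_def)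

lemma tame_one: "tame \<one>"
  using alpha_pos base_in_axis by (auto simp: tame_def mem_proj_set_singleton infdist_zero)

text \<open>
  Shift by powers of \<open>g\<close>, first on the left so that \<open>p\<close> is a nearest point of the axis, then on the
  right for the inverse. The second shift does not spoil the first by more than a bounded amount,
  and neither increases the length.
\<close>

lemma good_decomposition:
  assumes a: "a \<in> carrier G"
  obtains i j :: int and a' where "good a'" "a = g [^] i \<otimes> a' \<otimes> g [^] j" "len a' \<le> len a"
    "len (g [^] i) \<le> 2 * len a" "len (g [^] j) \<le> 2 * len a"
proof -
  obtain r where r: "r \<in> proj (\<phi> a p)" using proj_nonempty by blast
  then obtain i :: int where i: "r = \<phi> (g [^] i) p" using axisE proj_in_axis by metis
  define b where "b = inv (g [^] i) \<otimes> a"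
  have b: "b \<in> carrier G" using a by (simp add: b_def)
  have pb: "p \<in> proj (\<phi> b p)"
    using proj_shift[OF r, of "- i"] a by (simp add: i b_def act_mult int_pow_neg)
  have lb: "len b \<le> len a"
  proof -
    have "len b = dist (\<phi> a p) r"
      using a by (simp add: len_def b_def act_mult i dist_act_inv2) (rule dist_commute)
    also have "\<dots> \<le> dist (\<phi> a p) p"
      using r base_in_axis by (auto simp: mem_proj_set_singleton intro: infdist_le)
    finally show ?thesis by (simp add: len_def dist_commute)
  qed
  obtain r' where r': "r' \<in> proj (\<phi> (inv b) p)" using proj_nonempty by blast
  then obtain j :: int where j: "r' = \<phi> (g [^] j) p" using axisE proj_in_axis by metis
  define a' where "a' = b \<otimes> g [^] j"
  have a': "a' \<in> carrier G" using b by (simp add: a'_def)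
  have pa': "p \<in> proj (\<phi> (inv a') p)"
    using proj_shift[OF r', of "- j"] b by (simp add: j a'_def act_mult int_pow_neg inv_mult_group)
  have la': "len a' \<le> len b"
  proof -
    have "len a' = dist (\<phi> (inv b) p) r'"
      using b by (simp add: len_def a'_def act_mult j dist_act_inv)
    also have "\<dots> \<le> dist (\<phi> (inv b) p) p"
      using r' base_in_axis by (auto simp: mem_proj_set_singleton intro: infdist_le)
    also have "\<dots> = len b" using b by (simp add: len_def dist_act_inv)
    finally show ?thesis .
  qed
  \<comment> \<open>Here p and q are nearest points of the same point, so
    \<open>proj_dist_ge\<close> with both outer points equal bounds their distance.\<close>
  have g1: "dist p q \<le> 16 * \<alpha>" if q: "q \<in> proj (\<phi> (inv a') p)" for q
  proof (cases "\<alpha> < dist p q")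
    case True
    from proj_dist_ge[OF pa' q this] show ?thesis
      using alpha_pos zero_le_dist[of "\<phi> (inv a') p" p] zero_le_dist[of q "\<phi> (inv a') p"]
      unfolding dist_self by linarith
  qed (use alpha_pos in auto)
  \<comment> \<open>If q were far from p, the path from p to \<open>a' p\<close> would go via q
    (fact 1). On the translate of the axis by a', moving from \<open>a' p\<close> to
    \<open>b p\<close> is moving away from p (fact 2). Together they make q closer to
    \<open>b p\<close> than its nearest point p, up to 16\<alpha>.\<close>
  have g2: "dist p q \<le> 16 * \<alpha>" if q: "q \<in> proj (\<phi> a' p)" for q
  proof (rule ccontr)
    assume *: "\<not> dist p q \<le> 16 * \<alpha>"
    have 1: "dist p q + dist q (\<phi> a' p) - 8 * \<alpha> \<le> len a'"
      using proj_dist_ge[OF proj_axis[OF base_in_axis] q] * alpha_pos by (simp add: len_def)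
    let ?v = "\<phi> (inv (g [^] j)) p"
    have v: "\<phi> a' ?v = \<phi> b p" using b by (simp add: a'_def act_mult)
    have vax: "?v \<in> axis"
      unfolding axis_def by (rule range_eqI[of _ _ "- j"]) (simp add: int_pow_neg)
    have dv: "dist (\<phi> (inv a') p) ?v = len b"
      using v a' by (simp add: len_def dist_act_inv)
    have dv': "dist p ?v = dist (\<phi> a' p) (\<phi> b p)"
      using v a' by (metis dist_act)
    have dp: "dist (\<phi> (inv a') p) p = len a'"
      using a' by (simp add: len_def dist_act_inv)
    have 2: "len a' + dist (\<phi> a' p) (\<phi> b p) - 8 * \<alpha> \<le> len b"
    proof (cases "\<alpha> < dist p ?v")
      case True
      from proj_dist_ge[OF pa' proj_axis[OF vax] this] show ?thesis
        by (simp add: dv dv' dp)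
    next
      case False
      then have "dist (\<phi> a' p) (\<phi> b p) \<le> \<alpha>" by (simp add: dv')
      moreover have "len a' \<le> len b + dist (\<phi> a' p) (\<phi> b p)"
        by (simp add: len_def) (metis dist_commute dist_triangle)
      ultimately show ?thesis using alpha_pos by linarith
    qed
    have "len b \<le> dist (\<phi> b p) q"
      using pb proj_in_axis[OF q] infdist_le[of q axis "\<phi> b p"]
      by (simp add: mem_proj_set_singleton len_def dist_commute)
    moreover have "dist (\<phi> b p) q \<le> dist q (\<phi> a' p) + dist (\<phi> a' p) (\<phi> b p)"
      by (metis dist_commute dist_triangle)
    ultimately show False using 1 2 * by linarith
  qed
  show ?thesis
  proof (rule that[of a' i "- j"])
    show "good a'" using g1 g2 a' by (auto simp: good_def)
    show "a = g [^] i \<otimes> a' \<otimes> g [^] (- j)"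
    proof -
      have "g [^] i \<otimes> a' \<otimes> g [^] (- j) = g [^] i \<otimes> (b \<otimes> (g [^] j \<otimes> inv (g [^] j)))"
        using b by (simp add: a'_def m_assoc int_pow_neg)
      also have "\<dots> = (g [^] i \<otimes> inv (g [^] i)) \<otimes> a"
        using a b by (simp add: b_def m_assoc del: r_inv) (simp flip: m_assoc)
      finally show ?thesis using a by simp
    qed
    show "len a' \<le> len a" using la' lb by linarith
    \<comment> \<open>As r is at least as close to \<open>a p\<close> as p is, it lies within
      \<open>2 * len a\<close> of p. The same argument below treats r' and the inverse of b.\<close>
    have "len (g [^] i) = dist p r" by (simp add: len_def i)
    also have "\<dots> \<le> dist p (\<phi> a p) + dist (\<phi> a p) r" by (rule dist_triangle)
    also have "dist (\<phi> a p) r \<le> dist (\<phi> a p) p"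
      using r base_in_axis by (auto simp: mem_proj_set_singleton intro: infdist_le)
    finally show "len (g [^] i) \<le> 2 * len a" by (simp add: len_def dist_commute)
    have "len (g [^] (- j)) = dist p r'" by (simp add: int_pow_neg) (simp add: len_def j)
    also have "\<dots> \<le> dist p (\<phi> (inv b) p) + dist (\<phi> (inv b) p) r'" by (rule dist_triangle)
    also have "dist (\<phi> (inv b) p) r' \<le> dist (\<phi> (inv b) p) p"
      using r' base_in_axis by (auto simp: mem_proj_set_singleton intro: infdist_le)
    also have "dist p (\<phi> (inv b) p) + dist (\<phi> (inv b) p) p = 2 * len b"
      using b len_inv[OF b] by (simp add: len_def dist_commute)
    finally show "len (g [^] (- j)) \<le> 2 * len a" using lb by linarith
  qed
qed

text \<open>The point r is within 46\<alpha> of \<open>f p\<close>, r' is within 17\<alpha> of p,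
  and f moves p by more than 64 = 46 + 17 + 1 times \<alpha>.\<close>

lemma axis_power_far:
  assumes "tame w" "f = g [^] (n::int)" "64 * \<alpha> < len f"
    "r \<in> proj (\<phi> (f \<otimes> w) p)" "dist p r' \<le> 17 * \<alpha>"
  shows "\<alpha> < dist r' r"
proof -
  have "\<phi> (inv f) r \<in> proj (\<phi> w p)"
    using proj_shift[OF assms(4), of "- n"] assms(1,2)
    by (simp add: int_pow_neg tame_closed act_mult)
  then have "dist p (\<phi> (inv f) r) \<le> 46 * \<alpha>" using assms(1) by (simp add: tame_def)
  then have "dist r (\<phi> f p) \<le> 46 * \<alpha>"
    using assms(2) by (simp add: dist_act_inv2) (simp add: dist_commute)
  moreover have "len f \<le> dist p r' + dist r' r + dist r (\<phi> f p)"
    unfolding len_def by (rule dist_triangle4)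
  ultimately show ?thesis using assms by linarith
qed

text \<open>On the translate of the axis by a, the point p projects near \<open>a p\<close> and the
  endpoint of the word projects near \<open>a f p\<close>. These are far apart, so a geodesic from p
  to the endpoint passes near \<open>a p\<close>. The error in the length is 16 + 16 + 8 times
  \<alpha>.\<close>

lemma tame_step:
  assumes a: "good a" "40 * \<alpha> < len a" and w: "tame w"
    and f: "f = g [^] (n::int)" "64 * \<alpha> < len f"
  shows "tame (a \<otimes> f \<otimes> w)"
    and "len a + len w - len f - 40 * \<alpha> \<le> len (a \<otimes> f \<otimes> w)"
proof -
  have cl [simp]: "a \<in> carrier G" "f \<in> carrier G" "w \<in> carrier G"
    using a w f by (auto simp: good_closed tame_closed)
  let ?u = "\<phi> (f \<otimes> w) p"
  define z where "z = \<phi> a ?u"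
  have z: "\<phi> (a \<otimes> f \<otimes> w) p = z" by (simp add: z_def act_mult)
  obtain r0 where r0: "r0 \<in> proj (\<phi> a p)" using proj_nonempty by blast
  obtain r1 where r1: "r1 \<in> proj (\<phi> (inv a) p)" using proj_nonempty by blast
  obtain r2 where r2: "r2 \<in> proj ?u" using proj_nonempty by blast
  have d0: "dist p r0 \<le> 16 * \<alpha>" and d1: "dist p r1 \<le> 16 * \<alpha>"
    using a r0 r1 by (auto simp: good_def)
  have da: "dist (\<phi> (inv a) x) p = dist x (\<phi> a p)" for x by (simp add: dist_act_inv)
  have dz: "dist (\<phi> (inv a) x) ?u = dist x z" for x by (simp add: dist_act_inv z_def)
  have lu: "len w - len f \<le> dist p ?u"
    using len_mult_ge(1)[of f w] by (simp add: len_def)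
  have "\<alpha> < dist r1 r2"
    using axis_power_far[OF w f r2, of r1] d1 alpha_pos by auto
  from proj_dist_ge[OF r1 r2 this]
  have "dist (\<phi> (inv a) p) r1 + dist r1 r2 + dist r2 ?u - 8 * \<alpha> \<le> dist p z"
    by (simp add: dz)
  moreover have "dist p ?u \<le> dist p r1 + dist r1 r2 + dist r2 ?u"
    by (rule dist_triangle4)
  moreover have "len a \<le> dist (\<phi> (inv a) p) r1 + dist p r1"
    using dist_triangle2[of "\<phi> (inv a) p" p r1] by (simp add: da len_def)
  ultimately show "len a + len w - len f - 40 * \<alpha> \<le> len (a \<otimes> f \<otimes> w)"
    using d1 lu unfolding len_def[of "a \<otimes> f \<otimes> w"] z by linarith
  \<comment> \<open>If q were far from p, the way from p to z would go via q (fact 1) and the way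
    from q to \<open>a p\<close> via p (fact 2). The cases ask whether p and q have distant
    projections on the translate of the axis by a.\<close>
  have "dist p q \<le> 46 * \<alpha>" if q: "q \<in> proj z" for q
  proof (rule ccontr)
    assume far: "\<not> dist p q \<le> 46 * \<alpha>"
    obtain r3 where r3: "r3 \<in> proj (\<phi> (inv a) q)" using proj_nonempty by blast
    have qq: "q \<in> proj q" using q proj_axis proj_in_axis by blast
    have 1: "dist p q + dist q z - 8 * \<alpha> \<le> dist p z"
      using proj_dist_ge[OF proj_axis[OF base_in_axis] q] far alpha_pos by simp
    have t0: "dist p q \<le> dist p r0 + dist q r0" by (rule dist_triangle2)
    have "\<alpha> < dist q r0" using t0 far d0 alpha_pos by linarith
    from proj_dist_ge[OF qq r0 this]
    have "dist q r0 + dist r0 (\<phi> a p) - 8 * \<alpha> \<le> dist q (\<phi> a p)" by simp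
    moreover have "len a \<le> dist p r0 + dist r0 (\<phi> a p)"
      unfolding len_def by (rule dist_triangle)
    ultimately have 2: "dist p q + len a - 40 * \<alpha> \<le> dist q (\<phi> a p)"
      using t0 d0 by linarith
    show False
    proof (cases "\<alpha> < dist r3 r1")
      \<comment> \<open>The way from q to p would now pass near \<open>a p\<close>, making
        \<open>a p\<close> closer to q than p by about \<open>len a\<close>. With fact 2 this forces
        \<open>len a\<close> to be at most 40\<alpha>.\<close>
      case True
      from proj_dist_ge[OF r3 r1 this]
      have "dist (\<phi> (inv a) q) r3 + dist r3 r1 + dist r1 (\<phi> (inv a) p) - 8 * \<alpha> \<le> dist p q"
        by (simp add: dist_commute)
      moreover have "dist q (\<phi> a p) \<le> dist (\<phi> (inv a) q) r3 + dist r3 r1 + dist p r1"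
        using dist_triangle4[of "\<phi> (inv a) q" p r3 r1] unfolding da dist_commute[of r1 p] .
      moreover have "len a \<le> dist r1 (\<phi> (inv a) p) + dist p r1"
        using dist_triangle2[of "\<phi> (inv a) p" p r1] unfolding da len_def dist_commute[of r1] .
      ultimately show False using 2 d1 a(2) alpha_pos by linarith
    next
      \<comment> \<open>The way from q to z now passes near \<open>a p\<close> and, by fact 2, p. So
        z is farther from q than from p by about \<open>dist p q\<close>, while fact 1 says the
        opposite. The errors 82 + 8 bound \<open>dist p q\<close> by 45\<alpha>.\<close>
      case False
      have d3: "dist p r3 \<le> 17 * \<alpha>"
        using dist_triangle2[of p r3 r1] d1 False by linarith
      have "\<alpha> < dist r3 r2" using axis_power_far[OF w f r2 d3] .
      from proj_dist_ge[OF r3 r2 this]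
      have "dist (\<phi> (inv a) q) r3 + dist r3 r2 + dist r2 ?u - 8 * \<alpha> \<le> dist q z"
        by (simp add: dz)
      moreover have "dist q (\<phi> a p) \<le> dist (\<phi> (inv a) q) r3 + dist p r3"
        unfolding da[symmetric] by (rule dist_triangle2)
      moreover have "dist p ?u \<le> dist p r3 + dist r3 r2 + dist r2 ?u"
        by (rule dist_triangle4)
      moreover have "dist p z \<le> len a + dist p ?u"
        using dist_triangle[of p z "\<phi> a p"] by (simp add: len_def z_def)
      ultimately show False using 1 2 d3 far alpha_pos by linarith
    qed
  qed
  then show "tame (a \<otimes> f \<otimes> w)" by (simp add: tame_def z)
qed

end

section \<open>Geodesics crossing or following translates of the axis\<close>

context contracting_orbit
begin

text \<open>If p and x project to nearly the same place on the translate of the axis by a, the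
  barrier f makes geodesics from x to the endpoint of the word pass near \<open>a p\<close>. The
  error is 17 + 17 + 8 times \<alpha>.\<close>

lemma dist_transverse:
  assumes a: "good a" and w: "tame w"
    and f: "f = g [^] (n::int)" "64 * \<alpha> < len f"
    and r1: "r1 \<in> proj (\<phi> (inv a) p)" and r: "r \<in> proj (\<phi> (inv a) x)"
    and near: "dist r1 r \<le> \<alpha>"
  shows "dist x p - len a + len w - len f - 42 * \<alpha> \<le> dist x (\<phi> (a \<otimes> f \<otimes> w) p)"
proof -
  have cl [simp]: "a \<in> carrier G" "f \<in> carrier G" "w \<in> carrier G"
    using a w f by (auto simp: good_closed tame_closed)
  let ?u = "\<phi> (f \<otimes> w) p"
  obtain r2 where r2: "r2 \<in> proj ?u" using proj_nonempty by blast
  have dz: "dist (\<phi> (inv a) x) ?u = dist x (\<phi> (a \<otimes> f \<otimes> w) p)"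
    by (simp add: dist_act_inv act_mult)
  have "dist p r1 \<le> 16 * \<alpha>" using a r1 by (auto simp: good_def)
  then have d: "dist p r \<le> 17 * \<alpha>"
    using dist_triangle[of p r r1] near by linarith
  have "\<alpha> < dist r r2" using axis_power_far[OF w f r2 d] .
  from proj_dist_ge[OF r r2 this]
  have "dist (\<phi> (inv a) x) r + dist r r2 + dist r2 ?u - 8 * \<alpha> \<le> dist x (\<phi> (a \<otimes> f \<otimes> w) p)"
    by (simp add: dz)
  moreover have "dist x (\<phi> a p) \<le> dist (\<phi> (inv a) x) r + dist p r"
    using dist_triangle2[of "\<phi> (inv a) x" p r] by (simp add: dist_act_inv)
  moreover have "dist p ?u \<le> dist p r + dist r r2 + dist r2 ?u"
    by (rule dist_triangle4)
  moreover have "len w - len f \<le> dist p ?u"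
    using len_mult_ge(1)[of f w] by (simp add: len_def)
  moreover have "dist x p \<le> dist x (\<phi> a p) + len a"
    unfolding len_def by (rule dist_triangle2)
  ultimately show ?thesis using d by linarith
qed

text \<open>The geodesic comes within 2\<alpha> of the translate of r1 by a, which is within
  16\<alpha> of \<open>a p\<close> because a is good.\<close>

lemma good_near_geodesic:
  assumes geo: "geodesic_on {0..d} \<gamma>" "0 \<le> d" "\<gamma> 0 = p" "\<gamma> d = x"
    and a: "good a"
    and r1: "r1 \<in> proj (\<phi> (inv a) p)" and r: "r \<in> proj (\<phi> (inv a) x)"
    and far: "\<alpha> < dist r1 r"
  shows "\<exists>t\<in>{0..d}. dist (\<gamma> t) (\<phi> a p) \<le> 18 * \<alpha>"
proof -
  have cl [simp]: "a \<in> carrier G" using a by (simp add: good_closed)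
  have "geodesic_on {0..d} (\<lambda>t. \<phi> (inv a) (\<gamma> t))"
    using geo(1) by (simp add: geodesic_on_def)
  moreover have "r1 \<in> proj (\<phi> (inv a) (\<gamma> 0))" "r \<in> proj (\<phi> (inv a) (\<gamma> d))"
    using r1 r geo by simp_all
  moreover have "alpha_contracting \<alpha> axis" "axis \<noteq> {}"
    using contracting base_in_axis by (auto simp: axis_def)
  ultimately obtain t t' where t: "0 \<le> t" "t \<le> t'" "t' \<le> d"
      "dist (\<phi> (inv a) (\<gamma> t)) r1 \<le> 2 * \<alpha>"
    using contracting_geodesic_near_projections[OF ps _ _ alpha_pos _ geo(2) _ _ far] by metis
  have "dist p r1 \<le> 16 * \<alpha>" using a r1 by (auto simp: good_def)
  moreover have "dist (\<gamma> t) (\<phi> a p) \<le> dist (\<phi> (inv a) (\<gamma> t)) r1 + dist p r1"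
    using dist_triangle2[of "\<phi> (inv a) (\<gamma> t)" p r1] by (simp add: dist_act_inv)
  ultimately show ?thesis using t by (intro bexI[of _ t]) auto
qed

text \<open>The letters a such that the geodesic from p to x runs along the translate of the axis by
  a. Nearest points need not be unique; the existential form gives, for letters outside this set,
  closeness of every pair of nearest points.\<close>

definition shadowed :: "'g set \<Rightarrow> 'x \<Rightarrow> 'g set" where
  "shadowed A x = {a \<in> A. \<exists>r1 \<in> proj (\<phi> (inv a) p). \<exists>r \<in> proj (\<phi> (inv a) x). \<alpha> < dist r1 r}"

text \<open>The orbit points of shadowed letters lie within 18\<alpha> of one geodesic issuing from
  p, at times determined by their lengths up to 18\<alpha>. The lengths differ by at most 1, so
  these points are within 72\<alpha> + 1 of each other, and translation by the inverse of one such
  letter puts all of them in a ball that depends on neither A, m nor x.\<close>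

lemma card_shadowed_le:
  assumes A: "\<And>a. a \<in> A \<Longrightarrow> good a \<and> m - 1 < len a \<and> len a \<le> m"
  shows "card (shadowed A x) \<le> card {h \<in> carrier G. len h \<le> 72 * \<alpha> + 1}"
proof (cases "shadowed A x = {}")
  case False
  define d where "d = dist p x"
  obtain \<gamma> where geo: "geodesic_on {0..d} \<gamma>" "\<gamma> 0 = p" "\<gamma> d = x"
    using geodesic_space_segment[OF gs] d_def by metis
  have near: "\<exists>t\<in>{0..d}. dist (\<gamma> t) (\<phi> a p) \<le> 18 * \<alpha> \<and> \<bar>t - len a\<bar> \<le> 18 * \<alpha>"
    if a: "a \<in> shadowed A x" for a
  proof -
    obtain r1 r where r: "r1 \<in> proj (\<phi> (inv a) p)" "r \<in> proj (\<phi> (inv a) x)" "\<alpha> < dist r1 r"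
      using a unfolding shadowed_def by blast
    have "good a" "0 \<le> d" using a A by (auto simp: shadowed_def d_def)
    then obtain t where t: "t \<in> {0..d}" "dist (\<gamma> t) (\<phi> a p) \<le> 18 * \<alpha>"
      using good_near_geodesic[OF geo(1) _ geo(2,3) _ r] by blast
    have "dist p (\<gamma> t) = t"
      using geo t unfolding geodesic_on_def by fastforce
    then show ?thesis
      using t dist_triangle[of p "\<gamma> t" "\<phi> a p"] dist_triangle[of p "\<phi> a p" "\<gamma> t"]
      by (intro bexI[of _ t]) (auto simp: len_def dist_commute)
  qed
  obtain b where b: "b \<in> shadowed A x" using False by blast
  have cl: "a \<in> carrier G" if "a \<in> shadowed A x" for a
    using that A good_closed by (auto simp: shadowed_def)
  show ?thesis
  proof (rule card_inj_on_le[of "\<lambda>a. inv b \<otimes> a"])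
    show "inj_on (\<lambda>a. inv b \<otimes> a) (shadowed A x)"
      using cl b by (auto intro!: inj_onI)
    show "(\<lambda>a. inv b \<otimes> a) ` shadowed A x \<subseteq> {h \<in> carrier G. len h \<le> 72 * \<alpha> + 1}"
    proof clarify
      fix a assume a: "a \<in> shadowed A x"
      obtain t where t: "t \<in> {0..d}" "dist (\<gamma> t) (\<phi> a p) \<le> 18 * \<alpha>" "\<bar>t - len a\<bar> \<le> 18 * \<alpha>"
        using near[OF a] by blast
      obtain s where s: "s \<in> {0..d}" "dist (\<gamma> s) (\<phi> b p) \<le> 18 * \<alpha>" "\<bar>s - len b\<bar> \<le> 18 * \<alpha>"
        using near[OF b] by blast
      have "\<bar>len a - len b\<bar> \<le> 1" using A[of a] A[of b] a b by (auto simp: shadowed_def)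
      moreover have "dist (\<gamma> s) (\<gamma> t) = \<bar>s - t\<bar>"
        using geo s t unfolding geodesic_on_def by blast
      ultimately have "dist (\<gamma> s) (\<gamma> t) \<le> 36 * \<alpha> + 1" using s t by linarith
      moreover have "dist (\<phi> b p) (\<phi> a p) \<le> dist (\<gamma> s) (\<phi> b p) + dist (\<gamma> s) (\<gamma> t) + dist (\<gamma> t) (\<phi> a p)"
        using dist_triangle4[of "\<phi> b p" "\<phi> a p" "\<gamma> s" "\<gamma> t"] by (simp add: dist_commute)
      ultimately have "dist (\<phi> b p) (\<phi> a p) \<le> 72 * \<alpha> + 1" using s t by linarith
      then show "inv b \<otimes> a \<in> carrier G \<and> len (inv b \<otimes> a) \<le> 72 * \<alpha> + 1"
        using cl[OF a] cl[OF b] by (simp add: len_def act_mult dist_act_inv2)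
    qed
  qed (rule finite_len_le)
qed simp

end

section \<open>Words in good elements\<close>

definition words :: "'a set \<Rightarrow> nat \<Rightarrow> 'a list set" where
  "words A k = {ws. set ws \<subseteq> A \<and> length ws = k}"

lemma words_0 [simp]: "words A 0 = {[]}"
  by (auto simp: words_def)

lemma finite_words [simp]: "finite A \<Longrightarrow> finite (words A k)"
  by (simp add: words_def finite_lists_length_eq)

lemma card_words: "finite A \<Longrightarrow> card (words A k) = card A ^ k"
  by (simp add: words_def card_lists_length_eq)

lemma sum_words_Suc:
  assumes "finite A"
  shows "(\<Sum>ws\<in>words A (Suc k). F ws) = (\<Sum>a\<in>A. \<Sum>ws\<in>words A k. F (a # ws))"
proof -
  have "words A (Suc k) = (\<lambda>(a, ws). a # ws) ` (A \<times> words A k)"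
    by (auto simp: words_def length_Suc_conv image_iff)
  moreover have "inj_on (\<lambda>(a, ws). a # ws) (A \<times> words A k)"
    by (auto intro: inj_onI)
  ultimately show ?thesis
    by (simp add: sum.reindex sum.cartesian_product case_prod_unfold)
qed

primrec (in monoid) word_val :: "'a \<Rightarrow> 'a list \<Rightarrow> 'a" where
  "word_val f [] = \<one>"
| "word_val f (a # ws) = a \<otimes> f \<otimes> word_val f ws"

context contracting_orbit
begin

text \<open>By \<open>tame_step\<close> each letter adds at least
  \<open>m - 1 - len f - 40 * \<alpha>\<close>; the loss is taken with 42 to agree with
  \<open>dist_transverse\<close>.\<close>

lemma tame_word_val:
  assumes f: "f = g [^] (n::int)" "64 * \<alpha> < len f"
    and A: "\<And>a. a \<in> A \<Longrightarrow> good a \<and> m - 1 < len a \<and> len a \<le> m" and m: "40 * \<alpha> + 1 \<le> m"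
    and "ws \<in> words A k"
  shows "tame (word_val f ws) \<and> real k * (m - (len f + 42 * \<alpha> + 1)) \<le> len (word_val f ws)"
  using assms(5)
proof (induction ws arbitrary: k)
  case Nil
  then show ?case by (auto simp: words_def tame_one)
next
  case (Cons a ws)
  then obtain k' where k: "k = Suc k'" "ws \<in> words A k'" "a \<in> A"
    by (auto simp: words_def)
  have a: "good a" "40 * \<alpha> < len a" "m - 1 < len a" using A[OF k(3)] m by auto
  have IH: "tame (word_val f ws)"
    "real k' * (m - (len f + 42 * \<alpha> + 1)) \<le> len (word_val f ws)"
    using Cons.IH[OF k(2)] by auto
  have "real k * (m - (len f + 42 * \<alpha> + 1)) =
      real k' * (m - (len f + 42 * \<alpha> + 1)) + (m - (len f + 42 * \<alpha> + 1))"
    by (simp add: k algebra_simps)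
  then have "real k * (m - (len f + 42 * \<alpha> + 1)) \<le> len (a \<otimes> f \<otimes> word_val f ws)"
    using tame_step(2)[OF a(1,2) IH(1) f] IH(2) a(3) alpha_pos by linarith
  then show ?case using tame_step(1)[OF a(1,2) IH(1) f] by simp
qed

text \<open>
  The sum over all words splits according to the length of the prefix shadowed by \<open>x\<close>; each shadowed
  letter costs at most \<open>exp (2 * s * m)\<close> but is one of boundedly many out of
  \<open>card A \<ge> exp ((s + \<delta>) * m)\<close>.
\<close>

lemma sum_words_le:
  assumes s: "0 < s" and \<delta>: "0 < \<delta>" "\<delta> \<le> s"
  shows "\<exists>M\<ge>0. \<forall>A m f n x. f = g [^] (n::int) \<longrightarrow> len f = L \<longrightarrow> 64 * \<alpha> < L \<longrightarrow> finite A \<longrightarrow>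
    (\<forall>a\<in>A. good a \<and> m - 1 < len a \<and> len a \<le> m) \<longrightarrow> 40 * \<alpha> + 1 \<le> m \<longrightarrow>
    exp ((s + \<delta>) * m) \<le> card A \<longrightarrow>
    (\<Sum>ws\<in>words A k. exp (- s * dist x (\<phi> (word_val f ws) p)))
      \<le> M * exp ((s + \<delta> - k * \<delta>) * m) * card A ^ k * exp (- s * dist x p)"
proof (induction k)
  case 0
  show ?case
  proof (intro exI[of _ 1] conjI allI impI)
    fix A :: "'g set" and m f n x
    assume "40 * \<alpha> + 1 \<le> m"
    then have "0 \<le> (s + \<delta>) * m" using s \<delta> alpha_pos by simp
    then show "(\<Sum>ws\<in>words A 0. exp (- s * dist x (\<phi> (word_val f ws) p)))
      \<le> 1 * exp ((s + \<delta> - real 0 * \<delta>) * m) * real (card A ^ 0) * exp (- s * dist x p)"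
      by simp
  qed simp
next
  case (Suc k)
  then obtain M where M: "0 \<le> M" and IH:
    "\<And>A m f n x. \<lbrakk>f = g [^] (n::int); len f = L; 64 * \<alpha> < L; finite A;
      \<forall>a\<in>A. good a \<and> m - 1 < len a \<and> len a \<le> m; 40 * \<alpha> + 1 \<le> m; exp ((s + \<delta>) * m) \<le> card A\<rbrakk> \<Longrightarrow>
      (\<Sum>ws\<in>words A k. exp (- s * dist x (\<phi> (word_val f ws) p)))
        \<le> M * exp ((s + \<delta> - k * \<delta>) * m) * card A ^ k * exp (- s * dist x p)"
    by blast
  \<comment> \<open>The loss per letter is c, and K bounds the number of shadowed letters. The
    summands of \<open>M'\<close> come from words whose first letter is unshadowed and shadowed,
    respectively.\<close>
  define c where "c = L + 42 * \<alpha> + 1"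
  define K where "K = real (card {h \<in> carrier G. len h \<le> 72 * \<alpha> + 1})"
  define M' where "M' = exp (s * c * (k + 1)) + K * M * exp (s * L)"
  show ?case
  proof (intro exI[of _ M'] conjI allI impI)
    show "0 \<le> M'" using M by (simp add: M'_def K_def)
    fix A :: "'g set" and m f n x
    assume f: "f = g [^] (n::int)" "len f = L" "64 * \<alpha> < L" and A: "finite A"
      "\<forall>a\<in>A. good a \<and> m - 1 < len a \<and> len a \<le> m" and m: "40 * \<alpha> + 1 \<le> m"
      and card: "exp ((s + \<delta>) * m) \<le> card A"
    have m0: "0 \<le> m" using m alpha_pos by simp
    have cl: "f \<in> carrier G" "\<And>a. a \<in> A \<Longrightarrow> a \<in> carrier G"
      "\<And>ws. ws \<in> words A k \<Longrightarrow> word_val f ws \<in> carrier G"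
      using f A m tame_word_val[of f n A m _ k] by (auto simp: good_closed tame_closed)
    let ?e = "exp (- s * dist x p)"
    define R where "R = exp ((s + \<delta> - Suc k * \<delta>) * m) * ?e"
    have R0: "0 \<le> R" by (simp add: R_def)
    let ?S = "\<lambda>a. \<Sum>ws\<in>words A k. exp (- s * dist x (\<phi> (word_val f (a # ws)) p))"
    have good_letter: "?S a \<le> exp (s * c * (k + 1)) * R * card A ^ k"
      if a: "a \<in> A - shadowed A x" for a
    proof -
      have "exp (- s * dist x (\<phi> (word_val f (a # ws)) p)) \<le> exp (s * c * (k + 1)) * R"
        if ws: "ws \<in> words A k" for ws
      proof -
        obtain r1 where r1: "r1 \<in> proj (\<phi> (inv a) p)" using proj_nonempty by blast
        obtain r where r: "r \<in> proj (\<phi> (inv a) x)" using proj_nonempty by blast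
        have near: "dist r1 r \<le> \<alpha>" using a r1 r by (force simp: shadowed_def)
        have w: "tame (word_val f ws)" "real k * (m - c) \<le> len (word_val f ws)"
          using tame_word_val[of f n A m ws k] f A m ws by (auto simp: c_def)
        have "dist x p - len a + len (word_val f ws) - L - 42 * \<alpha> \<le> dist x (\<phi> (word_val f (a # ws)) p)"
          using dist_transverse[of a "word_val f ws" f n r1 r x] a A w f r1 r near by auto
        moreover have "len a \<le> m" using a A by auto
        ultimately have "dist x p - m + real k * (m - c) - c \<le> dist x (\<phi> (word_val f (a # ws)) p)"
          using w(2) unfolding c_def by linarith
        then have "- s * dist x (\<phi> (word_val f (a # ws)) p)
            \<le> - s * (dist x p - m + real k * (m - c) - c)"
          using s by simp
        also have "\<dots> = s * c * (k + 1) + (s - k * s) * m - s * dist x p"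
          by (simp add: algebra_simps)
        \<comment> \<open>Here \<open>\<delta> \<le> s\<close> weakens the true decay, of rate s per
          letter, to the rate of the claim.\<close>
        also have "\<dots> \<le> s * c * (k + 1) + (s - k * \<delta>) * m - s * dist x p"
          using \<delta> m0 by (intro diff_right_mono add_left_mono mult_right_mono diff_left_mono mult_left_mono) auto
        also have "\<dots> = s * c * (k + 1) + ((s + \<delta> - Suc k * \<delta>) * m + - s * dist x p)"
          by (simp add: algebra_simps)
        finally show ?thesis by (simp only: R_def exp_add[symmetric] exp_le_cancel_iff)
      qed
      then have "?S a \<le> real (card (words A k)) * (exp (s * c * (k + 1)) * R)"
        by (intro sum_bounded_above) auto
      then show ?thesis using A by (simp add: card_words mult_ac)
    qed
    \<comment> \<open>Translate by the inverse of \<open>a f\<close> and apply the induction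
      hypothesis at the translated point; this is why the bound is uniform in x.\<close>
    have shadowed_letter: "?S a \<le> M * exp (s * L) * R * card A ^ Suc k" if a: "a \<in> A" for a
    proof -
      let ?y = "\<phi> (inv (a \<otimes> f)) x"
      have "?S a = (\<Sum>ws\<in>words A k. exp (- s * dist ?y (\<phi> (word_val f ws) p)))"
        using a cl by (intro sum.cong) (simp_all add: dist_act_inv act_mult)
      also have "\<dots> \<le> M * exp ((s + \<delta> - k * \<delta>) * m) * card A ^ k * exp (- s * dist ?y p)"
        using f A m card by (intro IH) auto
      also have "\<dots> \<le> M * exp ((s + \<delta> - k * \<delta>) * m) * card A ^ k * (exp (s * (m + L)) * ?e)"
      proof (intro mult_left_mono)
        have "dist x p \<le> dist ?y p + len (a \<otimes> f)"
          using dist_triangle2[of x p "\<phi> (a \<otimes> f) p"] a cl by (simp add: dist_act_inv len_def)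
        moreover have "len (a \<otimes> f) \<le> m + L"
          using len_mult_le[of a f] a cl f A by force
        ultimately have "s * (dist x p) \<le> s * (dist ?y p + (m + L))" using s by simp
        then show "exp (- s * dist ?y p) \<le> exp (s * (m + L)) * ?e"
          unfolding exp_add[symmetric] by (simp add: algebra_simps)
      qed (use M in auto)
      \<comment> \<open>The surplus \<open>exp ((s + \<delta>) * m)\<close> is absorbed by one more
        factor \<open>card A\<close>. It is affordable since only K letters are shadowed, whereas
        summing over the other letters produces this factor anyway.\<close>
      also have "\<dots> = M * exp (s * L) * R * card A ^ k * exp ((s + \<delta>) * m)"
        unfolding R_def by (simp add: algebra_simps exp_add[symmetric])
      also have "\<dots> \<le> M * exp (s * L) * R * card A ^ k * card A"
        using card M R0 by (intro mult_left_mono) auto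
      finally show ?thesis by (simp add: mult_ac)
    qed
    have sub: "shadowed A x \<subseteq> A" by (auto simp: shadowed_def)
    have "(\<Sum>ws\<in>words A (Suc k). exp (- s * dist x (\<phi> (word_val f ws) p))) = (\<Sum>a\<in>A. ?S a)"
      by (rule sum_words_Suc[OF A(1)])
    also have "\<dots> = (\<Sum>a\<in>A - shadowed A x. ?S a) + (\<Sum>a\<in>shadowed A x. ?S a)"
      by (rule sum.subset_diff[OF sub A(1)])
    also have "\<dots> \<le> card (A - shadowed A x) * (exp (s * c * (k + 1)) * R * card A ^ k) +
        card (shadowed A x) * (M * exp (s * L) * R * card A ^ Suc k)"
      using good_letter shadowed_letter sub by (intro add_mono sum_bounded_above) auto
    also have "\<dots> \<le> card A * (exp (s * c * (k + 1)) * R * card A ^ k) +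
        K * (M * exp (s * L) * R * card A ^ Suc k)"
    proof (intro add_mono mult_right_mono)
      show "real (card (A - shadowed A x)) \<le> real (card A)"
        using A(1) by (simp add: card_mono)
      show "real (card (shadowed A x)) \<le> K"
        unfolding K_def using card_shadowed_le[of A m x] A(2) by auto
    qed (use R0 M in auto)
    also have "\<dots> = M' * exp ((s + \<delta> - Suc k * \<delta>) * m) * card A ^ Suc k * ?e"
      unfolding M'_def R_def by (simp add: algebra_simps)
    finally show "(\<Sum>ws\<in>words A (Suc k). exp (- s * dist x (\<phi> (word_val f ws) p)))
        \<le> M' * exp ((s + \<delta> - real (Suc k) * \<delta>) * m) * real (card A ^ Suc k) * ?e"
      by simp
  qed
qed

end

section \<open>Growth\<close>

context isom_action
begin

text \<open>A polynomial factor does not change the exponential rate. Degree 3 is what the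
  application produces: two from powers of g on either side, one from adding up unit shells.\<close>

lemma growth_rate_le:
  assumes "\<And>l. finite {h \<in> H. len h \<le> l}" and "\<one> \<in> H" and "0 < D"
    and bound: "\<And>l. 0 \<le> l \<Longrightarrow> card {h \<in> H. len h \<le> l} \<le> D * (1 + l) ^ 3 * exp (\<sigma> * l)"
  shows "growth_rate \<phi> p H \<le> ereal \<sigma>"
proof -
  let ?F = "\<lambda>l::real. 1 / l * ln (D * (1 + l) ^ 3 * exp (\<sigma> * l))"
  have "growth_rate \<phi> p H \<le> Limsup at_top (\<lambda>l. ereal (?F l))"
    unfolding growth_rate_def len_def[symmetric]
  proof (rule Limsup_mono, rule eventually_at_top_linorderI)
    fix l :: real assume l: "1 \<le> l"
    \<comment> \<open>The identity keeps the count positive, so that monotonicity of ln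
      applies.\<close>
    have "{h \<in> H. len h \<le> l} \<noteq> {}" using assms(2) l by force
    then have "0 < card {h \<in> H. len h \<le> l}" using assms(1) by (simp add: card_gt_0_iff)
    then show "ereal (1 / l * ln (card {h \<in> H. len h \<le> l})) \<le> ereal (?F l)"
      using bound[of l] l by (simp add: divide_right_mono)
  qed
  also have "\<dots> = ereal \<sigma>"
  proof (intro lim_imp_Limsup tendsto_ereal)
    have "((\<lambda>l. (ln D + 3 * ln (1 + l)) / l + \<sigma>) \<longlongrightarrow> 0 + \<sigma>) at_top"
      by (intro tendsto_add tendsto_const) real_asymp
    moreover have "eventually (\<lambda>l. (ln D + 3 * ln (1 + l)) / l + \<sigma> = ?F l) at_top"
    proof (rule eventually_at_top_linorderI)
      fix l :: real assume "1 \<le> l"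
      then show "(ln D + 3 * ln (1 + l)) / l + \<sigma> = ?F l"
        using \<open>0 < D\<close> by (simp add: ln_mult ln_realpow field_simps)
    qed
    ultimately show "(?F \<longlongrightarrow> \<sigma>) at_top"
      using Lim_transform_eventually by fastforce
  qed simp
  finally show ?thesis .
qed

lemma growth_rate_nonneg:
  assumes "\<And>l. finite {h \<in> H. len h \<le> l}" and "\<one> \<in> H"
  shows "0 \<le> growth_rate \<phi> p H"
proof -
  have "0 = Limsup at_top (\<lambda>l::real. ereal 0)" by (simp add: zero_ereal_def Limsup_const)
  also have "\<dots> \<le> growth_rate \<phi> p H"
    unfolding growth_rate_def len_def[symmetric]
  proof (rule Limsup_mono, rule eventually_at_top_linorderI)
    fix l :: real assume l: "1 \<le> l"
    have "{h \<in> H. len h \<le> l} \<noteq> {}" using assms(2) l by force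
    then have "0 < card {h \<in> H. len h \<le> l}" using assms(1) by (simp add: card_gt_0_iff)
    then show "ereal 0 \<le> ereal (1 / l * ln (card {h \<in> H. len h \<le> l}))"
      using l by simp
  qed
  finally show ?thesis .
qed

lemma growth_rate_mono:
  assumes "\<And>l. finite {h \<in> H'. len h \<le> l}" and "\<one> \<in> H" "H \<subseteq> H'"
  shows "growth_rate \<phi> p H \<le> growth_rate \<phi> p H'"
  unfolding growth_rate_def len_def[symmetric]
proof (rule Limsup_mono, rule eventually_at_top_linorderI)
  fix l :: real assume l: "1 \<le> l"
  have sub: "{h \<in> H. len h \<le> l} \<subseteq> {h \<in> H'. len h \<le> l}" using assms by auto
  have "{h \<in> H. len h \<le> l} \<noteq> {}" using assms(2) l by force
  then have "0 < card {h \<in> H. len h \<le> l}"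
    using sub assms(1) finite_subset by (metis card_gt_0_iff)
  moreover have "card {h \<in> H. len h \<le> l} \<le> card {h \<in> H'. len h \<le> l}"
    using sub assms(1) by (rule card_mono[rotated])
  ultimately show "ereal (1 / l * ln (card {h \<in> H. len h \<le> l}))
      \<le> ereal (1 / l * ln (card {h \<in> H'. len h \<le> l}))"
    using l by (simp add: divide_right_mono)
qed

text \<open>With s' strictly between the growth rate and s, the balls have at most
  \<open>exp (s' * k)\<close> elements for large k, so the sum over unit shells is dominated by a
  geometric series.\<close>

lemma summable_on_poincare:
  assumes fin: "\<And>l. finite {h \<in> H. len h \<le> l}" and "growth_rate \<phi> p H < ereal s" "0 < s"
  shows "(\<lambda>h. exp (- s * len h)) summable_on H"
proof -
  obtain s' where s': "growth_rate \<phi> p H < ereal s'" "s' < s"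
    using ereal_dense2[OF assms(2)] by auto
  have "eventually (\<lambda>l. ereal (1 / l * ln (card {h \<in> H. len h \<le> l})) < ereal s') at_top"
    using Limsup_lessD[OF s'(1)[unfolded growth_rate_def]] by (simp add: len_def)
  then obtain l0 where l0: "\<And>l. l0 \<le> l \<Longrightarrow> 1 / l * ln (card {h \<in> H. len h \<le> l}) < s'"
    unfolding eventually_at_top_linorder by auto
  \<comment> \<open>This dominates the contribution of the elements whose length rounds up to k,
    since these have length at least k - 1.\<close>
  define b where "b = (\<lambda>k::nat. real (card {h \<in> H. len h \<le> k}) * exp (- s * (real k - 1)))"
  have b0: "0 \<le> b k" for k by (simp add: b_def)
  have "summable b"
  proof (rule summable_comparison_test')
    show "summable (\<lambda>k. exp s * exp (s' - s) ^ k)"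
      using s' by (intro summable_mult summable_geometric) simp
    fix k assume k: "nat \<lceil>max 1 l0\<rceil> \<le> k"
    then have k: "max 1 l0 \<le> real k" by linarith
    have "real (card {h \<in> H. len h \<le> k}) \<le> exp (s' * k)"
    proof (cases "card {h \<in> H. len h \<le> k} = 0")
      case False
      have "1 / real k * ln (card {h \<in> H. len h \<le> k}) < s'" using l0[of k] k by simp
      then have "ln (card {h \<in> H. len h \<le> k}) < s' * k" using k by (simp add: field_simps)
      then have "exp (ln (card {h \<in> H. len h \<le> k})) \<le> exp (s' * k)" by simp
      moreover have "0 < real (card {h \<in> H. len h \<le> k})" using False by simp
      ultimately show ?thesis by (simp only: exp_ln)
    qed simp
    then have "b k \<le> exp (s' * k) * exp (- s * (real k - 1))"
      unfolding b_def by (intro mult_right_mono) auto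
    also have "\<dots> = exp s * exp (s' - s) ^ k"
      by (simp add: exp_of_nat_mult[symmetric] exp_add[symmetric] algebra_simps)
    finally show "norm (b k) \<le> exp s * exp (s' - s) ^ k" using b0 by simp
  qed
  show ?thesis
  proof (rule nonneg_bdd_above_summable_on)
    show "bdd_above (sum (\<lambda>h. exp (- s * len h)) ` {F. F \<subseteq> H \<and> finite F})"
    proof (rule bdd_aboveI2)
      fix F assume F: "F \<in> {F. F \<subseteq> H \<and> finite F}"
      let ?k = "\<lambda>h. nat \<lceil>len h\<rceil>"
      have "(\<Sum>h\<in>F. exp (- s * len h)) = (\<Sum>k\<in>?k ` F. \<Sum>h\<in>{h\<in>F. ?k h = k}. exp (- s * len h))"
        using F by (intro sum.image_gen) auto
      also have "\<dots> \<le> (\<Sum>k\<in>?k ` F. b k)"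
      proof (rule sum_mono)
        fix k assume "k \<in> ?k ` F"
        have *: "real k - 1 \<le> len h \<and> len h \<le> k" if "?k h = k" for h
          using that len_nonneg[of h] by linarith
        have "(\<Sum>h\<in>{h\<in>F. ?k h = k}. exp (- s * len h))
            \<le> real (card {h\<in>F. ?k h = k}) * exp (- s * (real k - 1))"
          using * \<open>0 < s\<close> by (intro sum_bounded_above) auto
        also have "\<dots> \<le> b k"
          unfolding b_def using F * fin[of k]
          by (intro mult_right_mono) (auto intro!: card_mono)
        finally show "(\<Sum>h\<in>{h\<in>F. ?k h = k}. exp (- s * len h)) \<le> b k" .
      qed
      also have "\<dots> \<le> suminf b"
        using F b0 \<open>summable b\<close> by (intro sum_le_suminf) auto
      finally show "(\<Sum>h\<in>F. exp (- s * len h)) \<le> suminf b" .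
    qed
  qed simp
qed

end

section \<open>Counting good elements and choosing the words\<close>

context contracting_orbit
begin

lemma axis_power_lower_bound:
  obtains \<kappa> c where "1 \<le> \<kappa>" "0 \<le> c" "\<And>n::int. \<bar>real_of_int n\<bar> \<le> \<kappa> * (len (g [^] n) + c)"
proof -
  obtain \<kappa> c where k: "1 \<le> \<kappa>" "0 \<le> c"
    and q: "\<And>n k::int. of_int \<bar>n - k\<bar> / \<kappa> - c \<le> dist (\<phi> (g [^] n) p) (\<phi> (g [^] k) p)"
    using qi unfolding int_quasi_isometric_embedding_def by blast
  have "\<bar>real_of_int n\<bar> \<le> \<kappa> * (len (g [^] n) + c)" for n :: int
    using q[of 0 n] k by (simp add: len_def field_simps)
  then show ?thesis using that k by blast
qed

lemma axis_power_unbounded: "\<exists>n::int. r < len (g [^] n)"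
proof -
  obtain \<kappa> c where k: "1 \<le> \<kappa>" "0 \<le> c" "\<And>n::int. \<bar>real_of_int n\<bar> \<le> \<kappa> * (len (g [^] n) + c)"
    using axis_power_lower_bound by blast
  define n where "n = \<lfloor>\<bar>\<kappa> * (r + c)\<bar>\<rfloor> + 1"
  have "\<kappa> * (r + c) < real_of_int n" unfolding n_def by linarith
  also have "\<dots> \<le> \<kappa> * (len (g [^] n) + c)" using k(3)[of n] by linarith
  finally show ?thesis using k by auto
qed

text \<open>The lower quasi-isometry bound allows only linearly many powers. The radius
  \<open>2 * l\<close> is that of the outer factors in \<open>good_decomposition\<close>.\<close>

lemma card_axis_powers_le:
  obtains C :: real where "0 < C" "\<And>l. finite {n::int. len (g [^] n) \<le> 2 * l}"
    "\<And>l. 0 \<le> l \<Longrightarrow> card {n::int. len (g [^] n) \<le> 2 * l} \<le> C * (1 + l)"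
proof -
  obtain \<kappa> c where k: "1 \<le> \<kappa>" "0 \<le> c" "\<And>n::int. \<bar>real_of_int n\<bar> \<le> \<kappa> * (len (g [^] n) + c)"
    using axis_power_lower_bound by blast
  define C where "C = 4 * \<kappa> + 2 * \<kappa> * c + 1"
  have "0 \<le> \<kappa> * c" using k by simp
  then have C: "0 < C" using k(1) by (simp add: C_def)
  have sub: "{n::int. len (g [^] n) \<le> 2 * l} \<subseteq> {- \<lfloor>\<kappa> * (2 * l + c)\<rfloor> .. \<lfloor>\<kappa> * (2 * l + c)\<rfloor>}" for l
  proof clarify
    fix n :: int assume "len (g [^] n) \<le> 2 * l"
    then have "\<kappa> * (len (g [^] n) + c) \<le> \<kappa> * (2 * l + c)" using k by simp
    then have "\<bar>real_of_int n\<bar> \<le> \<kappa> * (2 * l + c)" using k(3)[of n] by linarith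
    then show "n \<in> {- \<lfloor>\<kappa> * (2 * l + c)\<rfloor> .. \<lfloor>\<kappa> * (2 * l + c)\<rfloor>}"
      by (simp add: le_floor_iff minus_le_iff abs_le_iff)
  qed
  have "card {n::int. len (g [^] n) \<le> 2 * l} \<le> C * (1 + l)" if l: "0 \<le> l" for l :: real
  proof -
    have "card {n::int. len (g [^] n) \<le> 2 * l} \<le> card {- \<lfloor>\<kappa> * (2 * l + c)\<rfloor> .. \<lfloor>\<kappa> * (2 * l + c)\<rfloor>}"
      using sub by (intro card_mono) auto
    moreover have p0: "0 \<le> \<kappa> * (2 * l + c)" using k l by simp
    then have "0 \<le> \<lfloor>\<kappa> * (2 * l + c)\<rfloor>" by simp
    ultimately have "real (card {n::int. len (g [^] n) \<le> 2 * l}) \<le> 2 * (\<kappa> * (2 * l + c)) + 1"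
      by (simp add: nat_le_iff) linarith
    also have "\<dots> = 4 * \<kappa> * l + 2 * \<kappa> * c + 1" by (simp add: algebra_simps)
    also have "\<dots> \<le> C * (1 + l)"
    proof -
      have "0 \<le> \<kappa> * c * l" using k l by simp
      then show ?thesis using k l unfolding C_def by (simp add: algebra_simps)
    qed
    finally show ?thesis .
  qed
  moreover have "finite {n::int. len (g [^] n) \<le> 2 * l}" for l
    using sub by (rule finite_subset) simp
  ultimately show ?thesis using that C by blast
qed

text \<open>By \<open>good_decomposition\<close> the ball is covered by products of a good element
  of the ball with two powers of g, each with linearly many choices.\<close>

lemma card_ball_le_good:
  obtains C :: real where "0 < C" "\<And>l. 0 \<le> l \<Longrightarrow>
    card {h \<in> carrier G. len h \<le> l} \<le> C * (1 + l)\<^sup>2 * card {a. good a \<and> len a \<le> l}"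
proof -
  obtain C :: real where C: "0 < C" "\<And>l. finite {n::int. len (g [^] n) \<le> 2 * l}"
    "\<And>l. 0 \<le> l \<Longrightarrow> card {n::int. len (g [^] n) \<le> 2 * l} \<le> C * (1 + l)"
    using card_axis_powers_le by blast
  have "card {h \<in> carrier G. len h \<le> l} \<le> C\<^sup>2 * (1 + l)\<^sup>2 * card {a. good a \<and> len a \<le> l}"
    if l: "0 \<le> l" for l :: real
  proof -
    let ?I = "{n::int. len (g [^] n) \<le> 2 * l}" and ?A = "{a. good a \<and> len a \<le> l}"
    let ?f = "\<lambda>(i::int, a, j::int). g [^] i \<otimes> a \<otimes> g [^] j"
    have fin: "finite (?I \<times> ?A \<times> ?I)"
      using C(2)[of l] finite_subset[OF _ finite_len_le[of l], of ?A] good_closed by auto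
    have "{h \<in> carrier G. len h \<le> l} \<subseteq> ?f ` (?I \<times> ?A \<times> ?I)"
    proof clarify
      fix h assume h: "h \<in> carrier G" "len h \<le> l"
      then obtain i j :: int and a where a: "good a" "h = g [^] i \<otimes> a \<otimes> g [^] j" "len a \<le> len h"
        "len (g [^] i) \<le> 2 * len h" "len (g [^] j) \<le> 2 * len h"
        using good_decomposition[OF h(1)] by metis
      have "(i, a, j) \<in> ?I \<times> ?A \<times> ?I" using a h by auto
      moreover have "h = ?f (i, a, j)" using a by simp
      ultimately show "h \<in> ?f ` (?I \<times> ?A \<times> ?I)" by blast
    qed
    then have "card {h \<in> carrier G. len h \<le> l} \<le> card (?I \<times> ?A \<times> ?I)"
      using fin by (meson card_image_le card_mono finite_imageI order_trans)
    then have "real (card {h \<in> carrier G. len h \<le> l}) \<le> (real (card ?I))\<^sup>2 * card ?A"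
      by (simp add: card_cartesian_product power2_eq_square mult_ac flip: of_nat_mult)
    also have "\<dots> \<le> (C * (1 + l))\<^sup>2 * card ?A"
      using C(3)[OF l] by (intro mult_right_mono power_mono) auto
    finally show ?thesis by (simp add: power_mult_distrib)
  qed
  then show ?thesis using that[of "C\<^sup>2"] C(1) by simp
qed

text \<open>If all large unit shells of good elements were smaller than
  \<open>exp (\<sigma> * m)\<close>, adding them up would bound the balls of G by a polynomial times
  \<open>exp (\<sigma> * l)\<close>.\<close>

lemma many_good_elements:
  assumes "ereal \<sigma> < growth_rate \<phi> p (carrier G)" "0 < \<sigma>"
  shows "\<exists>m\<ge>m0. exp (\<sigma> * m) \<le> card {a. good a \<and> m - 1 < len a \<and> len a \<le> m}"
proof (rule ccontr)
  assume neg: "\<not> ?thesis"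
  define m1 where "m1 = max 0 m0"
  define C0 where "C0 = real (card {a. good a \<and> len a \<le> m1})"
  have finA: "finite {a. good a \<and> len a \<le> l}" for l
    by (rule finite_subset[OF _ finite_len_le[of l]]) (auto simp: good_closed)
  \<comment> \<open>The induction peels off n unit shells until the radius drops to m1; each shell
    is bounded crudely by the largest one.\<close>
  have ind: "card {a. good a \<and> len a \<le> l} \<le> C0 + n * exp (\<sigma> * l)" if "l \<le> m1 + real n" for n l
    using that
  proof (induction n arbitrary: l)
    case 0
    have "card {a. good a \<and> len a \<le> l} \<le> card {a. good a \<and> len a \<le> m1}"
      using 0 finA by (intro card_mono) auto
    then show ?case by (simp add: C0_def)
  next
    case (Suc n)
    show ?case
    proof (cases "l \<le> m1")
      case True
      have "card {a. good a \<and> len a \<le> l} \<le> card {a. good a \<and> len a \<le> m1}"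
        using True finA by (intro card_mono) auto
      then show ?thesis by (simp add: C0_def add_increasing2)
    next
      case False
      let ?S = "{a. good a \<and> l - 1 < len a \<and> len a \<le> l}"
      have "{a. good a \<and> len a \<le> l} = {a. good a \<and> len a \<le> l - 1} \<union> ?S" by auto
      then have "card {a. good a \<and> len a \<le> l} \<le> card {a. good a \<and> len a \<le> l - 1} + card ?S"
        using card_Un_le[of "{a. good a \<and> len a \<le> l - 1}" ?S] by simp
      then have "real (card {a. good a \<and> len a \<le> l})
          \<le> real (card {a. good a \<and> len a \<le> l - 1}) + real (card ?S)" by linarith
      moreover have "real (card {a. good a \<and> len a \<le> l - 1}) \<le> C0 + n * exp (\<sigma> * (l - 1))"
        using Suc.prems by (intro Suc.IH) simp
      moreover have "n * exp (\<sigma> * (l - 1)) \<le> n * exp (\<sigma> * l)"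
        using assms(2) by (intro mult_left_mono) auto
      moreover have "real (card ?S) \<le> exp (\<sigma> * l)"
      proof -
        have "m0 \<le> l" using False by (simp add: m1_def)
        then have "\<not> exp (\<sigma> * l) \<le> card ?S" using neg by blast
        then show ?thesis by linarith
      qed
      ultimately show ?thesis by (simp add: algebra_simps)
    qed
  qed
  obtain C :: real where C: "0 < C" "\<And>l. 0 \<le> l \<Longrightarrow>
      card {h \<in> carrier G. len h \<le> l} \<le> C * (1 + l)\<^sup>2 * card {a. good a \<and> len a \<le> l}"
    using card_ball_le_good by blast
  have "growth_rate \<phi> p (carrier G) \<le> ereal \<sigma>"
  proof (rule growth_rate_le[OF finite_len_le one_closed])
    show "0 < C * (C0 + 1)" using C by (simp add: C0_def add_nonneg_pos)
    fix l :: real assume l: "0 \<le> l"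
    have E: "1 \<le> exp (\<sigma> * l)" using l assms(2) by simp
    have "card {a. good a \<and> len a \<le> l} \<le> C0 + nat \<lceil>l\<rceil> * exp (\<sigma> * l)"
      by (rule ind) (simp add: m1_def, linarith)
    also have "\<dots> \<le> C0 + (1 + l) * exp (\<sigma> * l)"
      using l by (intro add_left_mono mult_right_mono) (auto, linarith)
    also have "\<dots> \<le> C0 * ((1 + l) * exp (\<sigma> * l)) + (1 + l) * exp (\<sigma> * l)"
    proof -
      have "1 \<le> (1 + l) * exp (\<sigma> * l)" using E l mult_mono[of 1 "1 + l" 1 "exp (\<sigma> * l)"] by simp
      then show ?thesis using mult_left_mono[of 1 "(1 + l) * exp (\<sigma> * l)" C0] by (simp add: C0_def)
    qed
    also have "\<dots> = (C0 + 1) * (1 + l) * exp (\<sigma> * l)" by (simp add: algebra_simps)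
    finally have "C * (1 + l)\<^sup>2 * card {a. good a \<and> len a \<le> l}
        \<le> C * (1 + l)\<^sup>2 * ((C0 + 1) * (1 + l) * exp (\<sigma> * l))"
      using C(1) by (intro mult_left_mono) auto
    also have "\<dots> = C * (C0 + 1) * (1 + l) ^ 3 * exp (\<sigma> * l)"
      by (simp add: power2_eq_square power3_eq_cube mult_ac)
    finally show "card {h \<in> carrier G. len h \<le> l} \<le> C * (C0 + 1) * (1 + l) ^ 3 * exp (\<sigma> * l)"
      using C(2)[OF l] by linarith
  qed
  then show False using assms(1) by simp
qed

lemma contracting_words_exist:
  assumes s: "0 < s" "ereal s < growth_rate \<phi> p (carrier G)"
  obtains A f and \<beta> :: real and k where "finite A" "A \<noteq> {}" "A \<subseteq> carrier G" "f \<in> carrier G" "\<beta> < 1"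
    "\<And>x. (\<Sum>ws\<in>words A k. exp (- s * dist x (\<phi> (word_val f ws) p)))
      \<le> \<beta> * card A ^ k * exp (- s * dist x p)"
    "\<And>x. (\<Sum>ws\<in>words (m_inv G ` A) k. exp (- s * dist x (\<phi> (word_val (inv f) ws) p)))
      \<le> \<beta> * card A ^ k * exp (- s * dist x p)"
proof -
  obtain \<sigma> where \<sigma>: "s < \<sigma>" "ereal \<sigma> < growth_rate \<phi> p (carrier G)"
    using ereal_dense2[OF s(2)] by auto
  \<comment> \<open>Small enough for \<open>sum_words_le\<close> and for \<open>s + \<delta>\<close>
    to stay below the growth rate of G.\<close>
  define \<delta> where "\<delta> = min s (\<sigma> - s)"
  have \<delta>: "0 < \<delta>" "\<delta> \<le> s" "ereal (s + \<delta>) < growth_rate \<phi> p (carrier G)"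
    using \<sigma> s by (auto simp: \<delta>_def intro: le_less_trans[of _ "ereal \<sigma>"])
  obtain n :: int where n: "64 * \<alpha> < len (g [^] n)" using axis_power_unbounded by blast
  define f where "f = g [^] n"
  \<comment> \<open>This k makes the exponent of the bound negative. The constant M depends on k and
    \<open>len f\<close> but not on m or A, so a large m chosen afterwards brings the factor below
    1.\<close>
  obtain k :: nat where k: "s + \<delta> < k * \<delta>" using reals_Archimedean3[OF \<delta>(1)] by blast
  obtain M where M: "0 \<le> M" and bound: "\<And>A m f' n' x. \<lbrakk>f' = g [^] (n'::int); len f' = len f;
      64 * \<alpha> < len f; finite A; \<forall>a\<in>A. good a \<and> m - 1 < len a \<and> len a \<le> m; 40 * \<alpha> + 1 \<le> m;
      exp ((s + \<delta>) * m) \<le> card A\<rbrakk> \<Longrightarrow>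
      (\<Sum>ws\<in>words A k. exp (- s * dist x (\<phi> (word_val f' ws) p)))
        \<le> M * exp ((s + \<delta> - k * \<delta>) * m) * card A ^ k * exp (- s * dist x p)"
    using sum_words_le[OF s(1) \<delta>(1,2), of "len f" k] by blast
  have "((\<lambda>m. M * exp ((s + \<delta> - k * \<delta>) * m)) \<longlongrightarrow> M * 0) at_top"
  proof (intro tendsto_mult tendsto_const filterlim_compose[OF exp_at_bot])
    show "filterlim (\<lambda>m. (s + \<delta> - k * \<delta>) * m) at_bot at_top"
      using k by (intro filterlim_tendsto_neg_mult_at_bot[OF tendsto_const _ filterlim_ident]) simp
  qed
  then have "eventually (\<lambda>m. M * exp ((s + \<delta> - k * \<delta>) * m) < 1) at_top"
    by (rule order_tendstoD) simp
  then obtain m0 where m0: "\<And>m. m0 \<le> m \<Longrightarrow> M * exp ((s + \<delta> - k * \<delta>) * m) < 1"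
    unfolding eventually_at_top_linorder by blast
  obtain m where m: "max m0 (40 * \<alpha> + 1) \<le> m"
    and card: "exp ((s + \<delta>) * m) \<le> card {a. good a \<and> m - 1 < len a \<and> len a \<le> m}"
    using many_good_elements[OF \<delta>(3), of "max m0 (40 * \<alpha> + 1)"] s \<delta> by auto
  define A where "A = {a. good a \<and> m - 1 < len a \<and> len a \<le> m}"
  have Acl: "A \<subseteq> carrier G" by (auto simp: A_def good_closed)
  have finA: "finite A"
    by (rule finite_subset[OF _ finite_len_le[of m]]) (auto simp: A_def good_closed)
  have inj: "inj_on (m_inv G) A" using Acl by (intro inj_onI) (metis inv_inv subsetD)
  let ?\<beta> = "M * exp ((s + \<delta> - k * \<delta>) * m)"
  show ?thesis
  proof (rule that[of A f ?\<beta> k])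
    have "0 < real (card A)" using card by (simp add: A_def) (metis exp_gt_zero less_le_trans of_nat_0_less_iff)
    then show "A \<noteq> {}" by auto
    show "f \<in> carrier G" by (simp add: f_def)
    show "?\<beta> < 1" using m0 m by simp
    show "(\<Sum>ws\<in>words A k. exp (- s * dist x (\<phi> (word_val f ws) p)))
      \<le> ?\<beta> * card A ^ k * exp (- s * dist x p)" for x
      using n m card finA by (intro bound[of _ n]) (auto simp: f_def A_def)
    have "(\<Sum>ws\<in>words (m_inv G ` A) k. exp (- s * dist x (\<phi> (word_val (inv f) ws) p)))
      \<le> ?\<beta> * card (m_inv G ` A) ^ k * exp (- s * dist x p)" for x
    \<comment> \<open>Inverses of letters are again good with the same length, and the inverse of f
      is a power of g of the same length, so the same M serves.\<close>
    proof (rule bound[of _ "- n"])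
      show "\<forall>a\<in>m_inv G ` A. good a \<and> m - 1 < len a \<and> len a \<le> m"
        using Acl by (auto simp: A_def good_inv good_closed)
      show "exp ((s + \<delta>) * m) \<le> card (m_inv G ` A)"
        using card inj by (simp add: card_image A_def)
    qed (use n m finA in \<open>auto simp: f_def int_pow_neg\<close>)
    then show "(\<Sum>ws\<in>words (m_inv G ` A) k. exp (- s * dist x (\<phi> (word_val (inv f) ws) p)))
      \<le> ?\<beta> * card A ^ k * exp (- s * dist x p)" for x
      using inj by (simp add: card_image)
  qed (use finA Acl in auto)
qed

end

section \<open>Means\<close>

lemma ell_infty_iff: "f \<in> ell_infty Q \<longleftrightarrow> (\<exists>C. \<forall>x\<in>carrier Q. \<bar>f x\<bar> \<le> C)"
  by (auto simp: ell_infty_def bounded_iff)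

lemma ell_infty_const: "(\<lambda>x. c) \<in> ell_infty Q"
  by (auto simp: ell_infty_iff)

lemma ell_infty_add:
  assumes "f \<in> ell_infty Q" "h \<in> ell_infty Q"
  shows "(\<lambda>x. f x + h x) \<in> ell_infty Q"
proof -
  obtain C D where "\<forall>x\<in>carrier Q. \<bar>f x\<bar> \<le> C" "\<forall>x\<in>carrier Q. \<bar>h x\<bar> \<le> D"
    using assms by (auto simp: ell_infty_iff)
  then have "\<forall>x\<in>carrier Q. \<bar>f x + h x\<bar> \<le> C + D" by (meson abs_triangle_ineq add_mono order_trans)
  then show ?thesis by (auto simp: ell_infty_iff)
qed

lemma ell_infty_cmult:
  assumes "f \<in> ell_infty Q"
  shows "(\<lambda>x. c * f x) \<in> ell_infty Q"
proof -
  obtain C where "\<forall>x\<in>carrier Q. \<bar>f x\<bar> \<le> C" using assms by (auto simp: ell_infty_iff)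
  then have "\<forall>x\<in>carrier Q. \<bar>c * f x\<bar> \<le> \<bar>c\<bar> * C" by (simp add: abs_mult mult_left_mono)
  then show ?thesis by (auto simp: ell_infty_iff)
qed

lemma mean_add:
  assumes "mean_on Q m" "f \<in> ell_infty Q" "h \<in> ell_infty Q"
  shows "m (\<lambda>x. f x + h x) = m f + m h"
  using assms by (simp add: mean_on_def)

lemma mean_cmult:
  assumes "mean_on Q m" "f \<in> ell_infty Q"
  shows "m (\<lambda>x. c * f x) = c * m f"
  using assms by (simp add: mean_on_def)

lemma mean_const:
  assumes "mean_on Q m"
  shows "m (\<lambda>x. c) = c"
  using mean_cmult[OF assms ell_infty_const[of 1], of c] assms by (simp add: mean_on_def)

lemma mean_mono:
  assumes m: "mean_on Q m" and f: "f \<in> ell_infty Q" and h: "h \<in> ell_infty Q"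
    and le: "\<And>x. x \<in> carrier Q \<Longrightarrow> f x \<le> h x"
  shows "m f \<le> m h"
proof -
  have "0 \<le> m (\<lambda>x. h x + - 1 * f x)"
    using m ell_infty_add[OF h ell_infty_cmult[OF f, of "- 1"]] le unfolding mean_on_def by simp
  also have "\<dots> = m h + m (\<lambda>x. - 1 * f x)"
    using mean_add[OF m h ell_infty_cmult[OF f, of "- 1"]] .
  also have "m (\<lambda>x. - 1 * f x) = - 1 * m f"
    by (rule mean_cmult[OF m f])
  finally show ?thesis by simp
qed

text \<open>The values outside the carrier do not affect the mean, which justifies encoding bounded
  functions by total ones.\<close>

lemma mean_cong:
  assumes "mean_on Q m" "f \<in> ell_infty Q" "h \<in> ell_infty Q"
    and "\<And>x. x \<in> carrier Q \<Longrightarrow> f x = h x"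
  shows "m f = m h"
  using mean_mono[OF assms(1), of f h] mean_mono[OF assms(1), of h f] assms by force

lemma mean_sum:
  assumes m: "mean_on Q m" and "finite I" and "\<And>i. i \<in> I \<Longrightarrow> f i \<in> ell_infty Q"
  shows "(\<lambda>x. \<Sum>i\<in>I. f i x) \<in> ell_infty Q \<and> m (\<lambda>x. \<Sum>i\<in>I. f i x) = (\<Sum>i\<in>I. m (f i))"
  using assms(2,3)
proof (induction I rule: finite_induct)
  case empty
  then show ?case using mean_const[OF m, of 0] ell_infty_const[of 0] by simp
next
  case (insert i I)
  then show ?case
    using mean_add[OF m, of "f i" "\<lambda>x. \<Sum>i\<in>I. f i x"] by (simp add: ell_infty_add)
qed

text \<open>The mean turns the cocycle identity into additivity. The family is indexed by I instead
  of being a set of elements, so that words with equal values are counted separately and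
  \<open>word_val\<close> need not be injective.\<close>

lemma amenable_log_cocycle:
  assumes "group Q" "amenable Q"
    and pos: "\<And>x. x \<in> carrier Q \<Longrightarrow> 0 < (v x :: real)"
    and harnack: "\<And>q. q \<in> carrier Q \<Longrightarrow>
      \<exists>C. \<forall>x\<in>carrier Q. v (inv\<^bsub>Q\<^esub> q \<otimes>\<^bsub>Q\<^esub> x) \<le> C * v x"
  obtains \<Psi> :: "'q \<Rightarrow> real"
  where "\<And>q r. q \<in> carrier Q \<Longrightarrow> r \<in> carrier Q \<Longrightarrow> \<Psi> (q \<otimes>\<^bsub>Q\<^esub> r) = \<Psi> q + \<Psi> r"
    and "\<And>(I :: 'i set) q \<beta>. finite I \<Longrightarrow> q ` I \<subseteq> carrier Q \<Longrightarrow>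
      (\<And>x. x \<in> carrier Q \<Longrightarrow> (\<Sum>i\<in>I. v (inv\<^bsub>Q\<^esub> q i \<otimes>\<^bsub>Q\<^esub> x)) \<le> \<beta> * v x) \<Longrightarrow>
      (\<Sum>i\<in>I. \<Psi> (q i)) \<le> \<beta> - card I"
proof -
  interpret Q: group Q by fact
  let ?s = "\<lambda>q x. inv\<^bsub>Q\<^esub> q \<otimes>\<^bsub>Q\<^esub> x"
  obtain m where m: "mean_on Q m"
    and inv: "\<And>q f. q \<in> carrier Q \<Longrightarrow> f \<in> ell_infty Q \<Longrightarrow> m (\<lambda>x. f (?s q x)) = m f"
    using assms(2) unfolding amenable_def by blast
  define F where "F q x = ln (v (?s q x)) - ln (v x)" for q x
  have upper: "\<exists>C. \<forall>x\<in>carrier Q. F q x \<le> C" if q: "q \<in> carrier Q" for q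
  proof -
    obtain C where C: "\<And>x. x \<in> carrier Q \<Longrightarrow> v (?s q x) \<le> C * v x" using harnack[OF q] by blast
    have "F q x \<le> ln C" if x: "x \<in> carrier Q" for x
    proof -
      have v: "0 < v (?s q x)" "0 < v x" using pos q x by auto
      then have "0 < C * v x" using C[OF x] by linarith
      then have "0 < C" using v by (simp add: zero_less_mult_iff)
      have "ln (v (?s q x)) \<le> ln (C * v x)" using C[OF x] v by simp
      also have "\<dots> = ln C + ln (v x)" using v \<open>0 < C\<close> by (simp add: ln_mult)
      finally show ?thesis by (simp add: F_def)
    qed
    then show ?thesis by blast
  qed
  \<comment> \<open>A lower bound for q is an upper bound for its inverse, evaluated at the
    translated point.\<close>
  have Fb: "F q \<in> ell_infty Q" if q: "q \<in> carrier Q" for q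
  proof -
    obtain C where C: "\<And>x. x \<in> carrier Q \<Longrightarrow> F q x \<le> C" using upper[OF q] by blast
    obtain D where D: "\<And>x. x \<in> carrier Q \<Longrightarrow> F (inv\<^bsub>Q\<^esub> q) x \<le> D" using upper[of "inv\<^bsub>Q\<^esub> q"] q by auto
    have "- D \<le> F q x" if x: "x \<in> carrier Q" for x
      using D[of "?s q x"] x q by (simp add: F_def Q.m_assoc[symmetric])
    then have "\<forall>x\<in>carrier Q. \<bar>F q x\<bar> \<le> max C D" using C by (fastforce simp: abs_le_iff)
    then show ?thesis by (auto simp: ell_infty_iff)
  qed
  show ?thesis
  proof (rule that[of "\<lambda>q. m (F q)"])
    fix q r assume q: "q \<in> carrier Q" and r: "r \<in> carrier Q"
    have shift: "(\<lambda>x. F r (?s q x)) \<in> ell_infty Q"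
      using Fb[OF r] q by (fastforce simp: ell_infty_iff)
    \<comment> \<open>The cocycle identity; invariance of the mean then removes the translation in
      the second summand.\<close>
    have "m (F (q \<otimes>\<^bsub>Q\<^esub> r)) = m (\<lambda>x. F q x + F r (?s q x))"
      using q r by (intro mean_cong[OF m] Fb ell_infty_add shift)
        (auto simp: F_def Q.inv_mult_group Q.m_assoc)
    also have "\<dots> = m (F q) + m (F r)"
      using q r by (simp add: mean_add[OF m Fb shift] inv Fb)
    finally show "m (F (q \<otimes>\<^bsub>Q\<^esub> r)) = m (F q) + m (F r)" .
  next
    fix I :: "'i set" and q \<beta>
    assume I: "finite I" "q ` I \<subseteq> carrier Q"
      and bound: "\<And>x. x \<in> carrier Q \<Longrightarrow> (\<Sum>i\<in>I. v (?s (q i) x)) \<le> \<beta> * v x"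
    have le: "(\<Sum>i\<in>I. F (q i) x) \<le> \<beta> - card I" if x: "x \<in> carrier Q" for x
    proof -
      have vx: "0 < v x" using pos x by auto
      have "(\<Sum>i\<in>I. F (q i) x) \<le> (\<Sum>i\<in>I. v (?s (q i) x) / v x - 1)"
      proof (rule sum_mono)
        fix i assume "i \<in> I"
        then have "0 < v (?s (q i) x)" using I x by (intro pos) auto
        then show "F (q i) x \<le> v (?s (q i) x) / v x - 1"
          using ln_le_minus_one[of "v (?s (q i) x) / v x"] vx by (simp add: F_def ln_div)
      qed
      also have "\<dots> = (\<Sum>i\<in>I. v (?s (q i) x)) / v x - card I"
        by (simp add: sum_subtractf sum_divide_distrib)
      also have "\<dots> \<le> \<beta> - card I"
        using bound[OF x] vx by (simp add: divide_le_eq)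
      finally show ?thesis .
    qed
    have S: "(\<lambda>x. \<Sum>i\<in>I. F (q i) x) \<in> ell_infty Q" "m (\<lambda>x. \<Sum>i\<in>I. F (q i) x) = (\<Sum>i\<in>I. m (F (q i)))"
      using mean_sum[OF m I(1), of "\<lambda>i. F (q i)"] Fb I(2) by auto
    have "(\<Sum>i\<in>I. m (F (q i))) \<le> m (\<lambda>x. \<beta> - card I)"
      unfolding S(2)[symmetric] by (rule mean_mono[OF m S(1) ell_infty_const le])
    then show "(\<Sum>i\<in>I. m (F (q i))) \<le> \<beta> - card I" by (simp add: mean_const[OF m])
  qed
qed

section \<open>Poincare series of cosets\<close>

lemma has_sum_finite_sum:
  fixes f :: "'i \<Rightarrow> 'a \<Rightarrow> real"
  assumes "finite I" "\<And>i. i \<in> I \<Longrightarrow> (f i has_sum s i) A"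
  shows "((\<lambda>x. \<Sum>i\<in>I. f i x) has_sum (\<Sum>i\<in>I. s i)) A"
  using assms by (induction I rule: finite_induct) (auto intro: has_sum_add)

context isom_action
begin

definition coset_series :: "real \<Rightarrow> 'g set \<Rightarrow> real" where
  "coset_series s q = infsum (\<lambda>x. exp (- s * len x)) q"

text \<open>Normality lets the factor from G move to the left of N, so translation in the quotient
  is translation of cosets as sets.\<close>

lemma left_translate_coset:
  assumes "N \<lhd> G" "h \<in> carrier G" "q \<in> carrier (G Mod N)"
  shows "inv\<^bsub>G Mod N\<^esub> (N #> h) \<otimes>\<^bsub>G Mod N\<^esub> q = (\<lambda>x. inv h \<otimes> x) ` q"
proof -
  interpret N: normal N G by fact
  obtain a where a: "a \<in> carrier G" "q = N #> a"
    using assms(3) by (auto simp: carrier_FactGroup)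
  have "inv\<^bsub>G Mod N\<^esub> (N #> h) \<otimes>\<^bsub>G Mod N\<^esub> q = N #> (inv h \<otimes> a)"
    using assms a by (simp add: N.inv_FactGroup carrier_FactGroup N.rcos_inv N.rcos_sum)
  also have "\<dots> = (N #> inv h) #> a"
    using assms a by (simp add: coset_mult_assoc N.subset)
  also have "\<dots> = (inv h <# N) #> a"
    using assms N.coset_eq by simp
  also have "\<dots> = (\<lambda>x. inv h \<otimes> x) ` q"
    using assms a N.subset by (auto simp: r_coset_def l_coset_def m_assoc image_iff subset_iff)
  finally show ?thesis .
qed

text \<open>Right multiplication by a representative a changes lengths by at most
  \<open>len a\<close>.\<close>

lemma summable_on_coset:
  assumes N: "N \<lhd> G" and sum: "(\<lambda>h. exp (- s * len h)) summable_on N" and "0 < s"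
    and q: "q \<in> carrier (G Mod N)"
  shows "(\<lambda>h. exp (- s * len h)) summable_on q"
proof -
  interpret N: normal N G by fact
  obtain a where a: "a \<in> carrier G" "q = N #> a"
    using q by (auto simp: carrier_FactGroup)
  have "(\<lambda>h. exp (- s * len (h \<otimes> a))) summable_on N"
  proof (rule summable_on_comparison_test)
    show "(\<lambda>h. exp (s * len a) * exp (- s * len h)) summable_on N"
      by (intro summable_on_cmult_right sum)
    fix h assume "h \<in> N"
    then have "h \<in> carrier G" by (rule N.mem_carrier)
    then have "s * (len h - len a) \<le> s * len (h \<otimes> a)"
      using len_mult_ge(2)[of h a] a \<open>0 < s\<close> by simp
    then show "exp (- s * len (h \<otimes> a)) \<le> exp (s * len a) * exp (- s * len h)"
      by (simp add: exp_add[symmetric] algebra_simps)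
  qed simp
  moreover have "inj_on (\<lambda>h. h \<otimes> a) N"
    using a by (intro inj_onI) (auto dest: N.mem_carrier)
  moreover have "q = (\<lambda>h. h \<otimes> a) ` N" using a by (auto simp: r_coset_def)
  ultimately show ?thesis by (simp add: summable_on_reindex o_def)
qed

text \<open>Reindexing makes the series of all translates of q run over q itself, so that
  inequalities between them can be checked term by term.\<close>

lemma coset_series_translate:
  assumes N: "N \<lhd> G" and sum: "(\<lambda>h. exp (- s * len h)) summable_on N" and s: "0 < s"
    and h: "h \<in> carrier G" and q: "q \<in> carrier (G Mod N)"
  shows "((\<lambda>x. exp (- s * dist (\<phi> x p) (\<phi> h p))) has_sum
    coset_series s (inv\<^bsub>G Mod N\<^esub> (N #> h) \<otimes>\<^bsub>G Mod N\<^esub> q)) q"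
proof -
  interpret N: normal N G by fact
  interpret Q: group "G Mod N" by (rule N.factorgroup_is_group)
  have cl: "x \<in> carrier G" if "x \<in> q" for x
    using q that h N.subset by (auto simp: carrier_FactGroup r_coset_def)
  let ?q = "inv\<^bsub>G Mod N\<^esub> (N #> h) \<otimes>\<^bsub>G Mod N\<^esub> q"
  have "N #> h \<in> carrier (G Mod N)" using h by (simp add: carrier_FactGroup)
  then have "?q \<in> carrier (G Mod N)" using q by blast
  then have "((\<lambda>x. exp (- s * len x)) has_sum coset_series s ?q) ?q"
    unfolding coset_series_def by (intro has_sum_infsum summable_on_coset[OF N sum s])
  moreover have "inj_on (\<lambda>x. inv h \<otimes> x) q" using cl h by (intro inj_onI) auto
  ultimately have "((\<lambda>x. exp (- s * len (inv h \<otimes> x))) has_sum coset_series s ?q) q"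
    unfolding left_translate_coset[OF N h q] by (simp add: has_sum_reindex o_def)
  moreover have "len (inv h \<otimes> x) = dist (\<phi> x p) (\<phi> h p)" if "x \<in> q" for x
    using cl[OF that] h by (simp add: len_def act_mult dist_act_inv2 dist_commute)
  ultimately show ?thesis by (simp cong: has_sum_cong)
qed

lemma coset_series_pos:
  assumes N: "N \<lhd> G" and sum: "(\<lambda>h. exp (- s * len h)) summable_on N" and s: "0 < s"
    and q: "q \<in> carrier (G Mod N)"
  shows "0 < coset_series s q"
proof -
  interpret N: normal N G by fact
  obtain a where a: "a \<in> q"
    using q rcos_self[OF _ N.subgroup_axioms] by (auto simp: carrier_FactGroup)
  have "(\<Sum>x\<in>{a}. exp (- s * len x)) \<le> coset_series s q"
    unfolding coset_series_def
    using a by (intro finite_sum_le_infsum summable_on_coset[OF N sum s q]) auto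
  then have "exp (- s * len a) \<le> coset_series s q" by simp
  then show ?thesis by (rule less_le_trans[OF exp_gt_zero])
qed

text \<open>Apply \<open>amenable_log_cocycle\<close> to \<open>coset_series s\<close>. The triangle
  inequality gives the Harnack constant \<open>exp (s * len h)\<close>, and \<Phi> is lifted from
  the quotient.\<close>

lemma amenable_quotient_homomorphism:
  assumes N: "N \<lhd> G" and amen: "amenable (G Mod N)"
    and sum: "(\<lambda>h. exp (- s * len h)) summable_on N" and s: "0 < s"
  obtains \<Phi> :: "'g \<Rightarrow> real"
  where "\<And>h k. h \<in> carrier G \<Longrightarrow> k \<in> carrier G \<Longrightarrow> \<Phi> (h \<otimes> k) = \<Phi> h + \<Phi> k"
    and "\<And>(I :: 'i set) h \<beta>. finite I \<Longrightarrow> h ` I \<subseteq> carrier G \<Longrightarrow>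
      (\<And>x. (\<Sum>i\<in>I. exp (- s * dist x (\<phi> (h i) p))) \<le> \<beta> * exp (- s * dist x p)) \<Longrightarrow>
      (\<Sum>i\<in>I. \<Phi> (h i)) \<le> \<beta> - card I"
proof -
  interpret N: normal N G by fact
  interpret Q: group "G Mod N" by (rule N.factorgroup_is_group)
  let ?v = "coset_series s"
  note translate = coset_series_translate[OF N sum s]
  have has: "((\<lambda>x. exp (- s * dist (\<phi> x p) p)) has_sum ?v q) q" if "q \<in> carrier (G Mod N)" for q
    using summable_on_coset[OF N sum s that] by (simp add: coset_series_def len_def dist_commute)
  have harnack: "\<exists>C. \<forall>x\<in>carrier (G Mod N). ?v (inv\<^bsub>G Mod N\<^esub> q \<otimes>\<^bsub>G Mod N\<^esub> x) \<le> C * ?v x"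
    if q: "q \<in> carrier (G Mod N)" for q
  proof -
    obtain h where h: "h \<in> carrier G" "q = N #> h" using q by (auto simp: carrier_FactGroup)
    show ?thesis
    proof (intro exI[of _ "exp (s * len h)"] ballI)
      fix x assume x: "x \<in> carrier (G Mod N)"
      show "?v (inv\<^bsub>G Mod N\<^esub> q \<otimes>\<^bsub>G Mod N\<^esub> x) \<le> exp (s * len h) * ?v x"
        unfolding h(2)
      proof (rule has_sum_mono[OF translate[OF h(1) x] has_sum_cmult_right[OF has[OF x]]])
        fix y
        have "dist (\<phi> y p) p \<le> dist (\<phi> y p) (\<phi> h p) + len h"
          unfolding len_def by (rule dist_triangle2)
        then have "s * dist (\<phi> y p) p \<le> s * (dist (\<phi> y p) (\<phi> h p) + len h)" using s by simp
        then show "exp (- s * dist (\<phi> y p) (\<phi> h p)) \<le> exp (s * len h) * exp (- s * dist (\<phi> y p) p)"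
          by (simp add: exp_add[symmetric] algebra_simps)
      qed
    qed
  qed
  show ?thesis
  proof (rule amenable_log_cocycle[OF Q.is_group amen coset_series_pos[OF N sum s] harnack])
    fix \<Psi> :: "'g set \<Rightarrow> real"
    assume hom: "\<And>q r. q \<in> carrier (G Mod N) \<Longrightarrow> r \<in> carrier (G Mod N) \<Longrightarrow>
        \<Psi> (q \<otimes>\<^bsub>G Mod N\<^esub> r) = \<Psi> q + \<Psi> r"
    and bound: "\<And>(I :: 'i set) q \<beta>. finite I \<Longrightarrow> q ` I \<subseteq> carrier (G Mod N) \<Longrightarrow>
      (\<And>x. x \<in> carrier (G Mod N) \<Longrightarrow>
        (\<Sum>i\<in>I. ?v (inv\<^bsub>G Mod N\<^esub> q i \<otimes>\<^bsub>G Mod N\<^esub> x)) \<le> \<beta> * ?v x) \<Longrightarrow>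
      (\<Sum>i\<in>I. \<Psi> (q i)) \<le> \<beta> - card I"
    show thesis
    proof (rule that[of "\<lambda>h. \<Psi> (N #> h)"])
      show "\<Psi> (N #> (h \<otimes> k)) = \<Psi> (N #> h) + \<Psi> (N #> k)" if "h \<in> carrier G" "k \<in> carrier G" for h k
        using hom[of "N #> h" "N #> k"] that by (simp add: carrier_FactGroup N.rcos_sum)
      fix I :: "'i set" and h \<beta>
      assume I: "finite I" "h ` I \<subseteq> carrier G"
        and le: "\<And>x. (\<Sum>i\<in>I. exp (- s * dist x (\<phi> (h i) p))) \<le> \<beta> * exp (- s * dist x p)"
      show "(\<Sum>i\<in>I. \<Psi> (N #> h i)) \<le> \<beta> - card I"
      proof (rule bound[OF I(1)])
        show "(\<lambda>i. N #> h i) ` I \<subseteq> carrier (G Mod N)" using I by (auto simp: carrier_FactGroup)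
        fix x assume x: "x \<in> carrier (G Mod N)"
        show "(\<Sum>i\<in>I. ?v (inv\<^bsub>G Mod N\<^esub> (N #> h i) \<otimes>\<^bsub>G Mod N\<^esub> x)) \<le> \<beta> * ?v x"
        \<comment> \<open>The assumed inequality is used at the orbit points
          \<open>\<phi> y p\<close> and summed over y in the coset x.\<close>
        proof (rule has_sum_mono[OF has_sum_finite_sum[OF I(1)] has_sum_cmult_right[OF has[OF x]]])
          show "((\<lambda>y. exp (- s * dist (\<phi> y p) (\<phi> (h i) p))) has_sum
              ?v (inv\<^bsub>G Mod N\<^esub> (N #> h i) \<otimes>\<^bsub>G Mod N\<^esub> x)) x" if "i \<in> I" for i
            using that I x by (intro translate) auto
        qed (rule le)
      qed
    qed
  qed
qed

section \<open>Homomorphisms evaluated on words\<close>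

lemma word_val_closed:
  assumes "f \<in> carrier G" "set ws \<subseteq> carrier G"
  shows "word_val f ws \<in> carrier G"
  using assms(2) by (induction ws) (auto simp: assms(1))

lemma hom_word_val:
  fixes \<Phi> :: "'g \<Rightarrow> real"
  assumes hom: "\<And>h k. h \<in> carrier G \<Longrightarrow> k \<in> carrier G \<Longrightarrow> \<Phi> (h \<otimes> k) = \<Phi> h + \<Phi> k"
    and f: "f \<in> carrier G" and "set ws \<subseteq> carrier G"
  shows "\<Phi> (word_val f ws) = (\<Sum>a\<leftarrow>ws. \<Phi> a) + length ws * \<Phi> f"
  using assms(3)
proof (induction ws)
  case Nil
  then show ?case using hom[of \<one> \<one>] by simp
next
  case (Cons a ws)
  then show ?case
    using f hom[of "a \<otimes> f" "word_val f ws"] hom[of a f] word_val_closed[OF f]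
    by (simp add: algebra_simps)
qed

text \<open>Inverting each letter and f without reversing the order does not invert the word, but
  the values of \<Phi> are real numbers, so the order is irrelevant.\<close>

lemma sum_hom_inverse_words:
  fixes \<Phi> :: "'g \<Rightarrow> real"
  assumes hom: "\<And>h k. h \<in> carrier G \<Longrightarrow> k \<in> carrier G \<Longrightarrow> \<Phi> (h \<otimes> k) = \<Phi> h + \<Phi> k"
    and f: "f \<in> carrier G" and A: "A \<subseteq> carrier G"
  shows "(\<Sum>ws\<in>words (m_inv G ` A) k. \<Phi> (word_val (inv f) ws)) = - (\<Sum>ws\<in>words A k. \<Phi> (word_val f ws))"
proof -
  have inv: "\<Phi> (inv h) = - \<Phi> h" if "h \<in> carrier G" for h
    using hom[of \<one> \<one>] hom[of h "inv h"] that by simp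
  have inj: "inj_on (m_inv G) (carrier G)" by (intro inj_onI) (metis inv_inv)
  have "words (m_inv G ` A) k = map (m_inv G) ` words A k"
  proof (intro equalityI subsetI)
    fix ws assume "ws \<in> words (m_inv G ` A) k"
    then have ws: "set ws \<subseteq> m_inv G ` A" "length ws = k" by (auto simp: words_def)
    have "inv (inv a) = a" if a: "a \<in> set ws" for a
    proof -
      obtain b where "b \<in> A" "a = inv b" using a ws(1) by blast
      then show ?thesis using A by auto
    qed
    then have "map (m_inv G) (map (m_inv G) ws) = ws"
      by (simp add: map_idI)
    moreover have "map (m_inv G) ws \<in> words A k" using ws A by (force simp: words_def)
    ultimately show "ws \<in> map (m_inv G) ` words A k" by (metis imageI)
  qed (auto simp: words_def image_subset_iff subset_iff)
  moreover have "inj_on (map (m_inv G)) (words A k)"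
    using A by (intro inj_on_mapI inj_on_subset[OF inj]) (auto simp: words_def)
  moreover have "\<Phi> (word_val (inv f) (map (m_inv G) ws)) = - \<Phi> (word_val f ws)" if "ws \<in> words A k" for ws
  proof -
    have ws: "set ws \<subseteq> carrier G" using that A by (auto simp: words_def)
    have "(\<Sum>a\<leftarrow>ws. \<Phi> (inv a)) = - (\<Sum>a\<leftarrow>ws. \<Phi> a)"
      using ws by (induction ws) (auto simp: inv)
    then show ?thesis
      using hom_word_val[OF hom f ws] hom_word_val[OF hom, of "inv f" "map (m_inv G) ws"] ws f
      by (auto simp: inv o_def image_subset_iff subset_iff)
  qed
  ultimately show ?thesis by (simp add: sum.reindex sum_negf)
qed

end

section \<open>Amenable quotients\<close>

lemma (in contracting_orbit) amenable_quotient_growth_ge: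
  assumes N: "N \<lhd> G" and amen: "amenable (G Mod N)"
  shows "growth_rate \<phi> p (carrier G) \<le> growth_rate \<phi> p N"
proof (rule ccontr)
  interpret N: normal N G by fact
  assume "\<not> ?thesis"
  then obtain s where s: "growth_rate \<phi> p N < ereal s" "ereal s < growth_rate \<phi> p (carrier G)"
    using ereal_dense2 by (metis linorder_not_le)
  have finN: "finite {h \<in> N. len h \<le> l}" for l
    by (rule finite_subset[OF _ finite_len_le[of l]]) (auto dest: N.mem_carrier)
  \<comment> \<open>This makes s positive, as required by the Poincare series and the word
    estimates.\<close>
  have "0 \<le> growth_rate \<phi> p N" by (rule growth_rate_nonneg[OF finN N.one_closed])
  then have "0 < ereal s" using s(1) by (rule order.strict_trans1)
  then have s0: "0 < s" by simp
  show False
  proof (rule contracting_words_exist[OF s0 s(2)])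
    fix A f k and \<beta> :: real
    assume A: "finite A" "A \<noteq> {}" "A \<subseteq> carrier G" and f: "f \<in> carrier G"
      and \<beta>: "\<beta> < 1"
      and le: "\<And>x. (\<Sum>ws\<in>words A k. exp (- s * dist x (\<phi> (word_val f ws) p)))
        \<le> \<beta> * card A ^ k * exp (- s * dist x p)"
      and le_inv: "\<And>x. (\<Sum>ws\<in>words (m_inv G ` A) k. exp (- s * dist x (\<phi> (word_val (inv f) ws) p)))
        \<le> \<beta> * card A ^ k * exp (- s * dist x p)"
    show False
    proof (rule amenable_quotient_homomorphism[OF N amen summable_on_poincare[OF finN s(1) s0] s0])
      fix \<Phi> :: "'g \<Rightarrow> real"
      assume hom: "\<And>h k. h \<in> carrier G \<Longrightarrow> k \<in> carrier G \<Longrightarrow> \<Phi> (h \<otimes> k) = \<Phi> h + \<Phi> k"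
        and bound: "\<And>(I :: 'g list set) h \<beta>. finite I \<Longrightarrow> h ` I \<subseteq> carrier G \<Longrightarrow>
          (\<And>x. (\<Sum>i\<in>I. exp (- s * dist x (\<phi> (h i) p))) \<le> \<beta> * exp (- s * dist x p)) \<Longrightarrow>
          (\<Sum>i\<in>I. \<Phi> (h i)) \<le> \<beta> - card I"
      have inj: "inj_on (m_inv G) A" using A(3) by (intro inj_onI) (metis inv_inv subsetD)
      have "0 < card A" using A by (simp add: card_gt_0_iff)
      then have "0 < real (card A ^ k)" by simp
      \<comment> \<open>This negative number bounds the sum of \<Phi> over the words and also over
        the inverse words, although these two sums are opposite.\<close>
      then have neg: "\<beta> * card A ^ k - card A ^ k < 0" using \<beta> by simp
      have "(\<Sum>ws\<in>words A k. \<Phi> (word_val f ws)) \<le> \<beta> * card A ^ k - card (words A k)"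
      proof (intro bound le)
        show "word_val f ` words A k \<subseteq> carrier G"
        proof clarify
          fix ws assume "ws \<in> words A k"
          then have "set ws \<subseteq> carrier G" using A(3) by (auto simp: words_def)
          then show "word_val f ws \<in> carrier G" by (rule word_val_closed[OF f])
        qed
      qed (use A in simp)
      moreover have "(\<Sum>ws\<in>words (m_inv G ` A) k. \<Phi> (word_val (inv f) ws))
          \<le> \<beta> * card A ^ k - card (words (m_inv G ` A) k)"
      proof (intro bound le_inv)
        show "word_val (inv f) ` words (m_inv G ` A) k \<subseteq> carrier G"
        proof clarify
          fix ws assume "ws \<in> words (m_inv G ` A) k"
          then have "set ws \<subseteq> carrier G" using A(3) by (auto simp: words_def)
          then show "word_val (inv f) ws \<in> carrier G" by (rule word_val_closed[OF inv_closed[OF f]])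
        qed
      qed (use A in simp)
      ultimately show False
        using neg A(1) sum_hom_inverse_words[OF hom f A(3), of k]
        by (simp add: card_words card_image[OF inj])
    qed
  qed
qed

theorem theorem1p2:
  fixes G :: "('g, 'm) monoid_scheme"
    and \<phi> :: "'g \<Rightarrow> 'x::metric_space \<Rightarrow> 'x"
    and N :: "'g set"
    and p :: 'x
  assumes "proper_space TYPE('x)"
    and "geodesic_space TYPE('x)"
    and "group G"
    and "isometric_action G \<phi>"
    and "proper_action G \<phi>"
    and "\<exists>g. contracting_element G \<phi> g"
    and "N \<lhd> G"
    and "amenable (G Mod N)"
  shows "growth_rate \<phi> p N = growth_rate \<phi> p (carrier G)"
proof -
  obtain g \<alpha> where g: "g \<in> carrier G" "0 < \<alpha>"
    "int_quasi_isometric_embedding (\<lambda>n::int. \<phi> (g [^]\<^bsub>G\<^esub> n) p)"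
    "alpha_contracting \<alpha> (range (\<lambda>n::int. \<phi> (g [^]\<^bsub>G\<^esub> n) p))"
    using assms(6) unfolding contracting_element_def contracting_set_def by blast
  interpret contracting_orbit G \<phi> p g \<alpha>
    using assms(1-5) g
    by (intro contracting_orbit.intro isom_action.intro isom_action_axioms.intro
        contracting_orbit_axioms.intro)
  interpret N: normal N G by fact
  show ?thesis
  proof (rule antisym)
    show "growth_rate \<phi> p N \<le> growth_rate \<phi> p (carrier G)"
      by (rule growth_rate_mono[OF finite_len_le N.one_closed N.subset])
    show "growth_rate \<phi> p (carrier G) \<le> growth_rate \<phi> p N"
      by (rule amenable_quotient_growth_ge[OF assms(7,8)])
  qed
qed

end
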